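(* Consider the changepoint double array described in the context. Suppose (post-change separation) that $F_{P_0}$ and $H$ are continuous, $H(0)=0$, and $\sup_{t\in[0,1]}|H(t)-t|>0$. Suppose also (local KL support) that $H\ll U$ with $h:=dH/dU$ and $D_{\mathrm{KL}}(H\|U)=\int_0^1\log h\,dH\in(0,\infty)$, that $\phi:=\log h$ is bounded and Lipschitz, and that there are constants $a,c\ge0$ such that for every $r\ge1$ and all $z_1,\dots,z_r\in[0,1]$, $$\log\int_\Theta\prod_{i=1}^rf_\theta(z_i)\,d\Pi(\theta)\ge\sum_{i=1}^r\log h(z_i)-a\log r-c.$$ Let $w_k=1$ for all $k\ge1$, and let $(\gamma_n)$ be a deterministic sequence of positive thresholds with $\gamma_n\to\infty$ and $\log\gamma_n=o(T_n)$. Then for every $A>1/D_{\mathrm{KL}}(H\|U)$, $$\mathbb P_{P_0,T_n,P_1}\{\tau_{n,Z,w}(\gamma_n)\le T_n+A\log\gamma_n\}\to1.$$ If, in addition, $T_n=o(\gamma_n)$, then $$\mathbb P_{P_0,T_n,P_1}\{\tau_{n,Z,w}(\gamma_n)>T_n\}\ge1-\frac{T_n}{\gamma_n}\to1,\qquad \mathbb P_{P_0,T_n,P_1}\{T_n<\tau_{n,Z,w}(\gamma_n)\le T_n+A\log\gamma_n\}\to1,$$ $$\mathbb P_{P_0,T_n,P_1}\{\tau_{n,Z,w}(\gamma_n)>T_n+A\log\gamma_n\mid\tau_{n,Z,w}(\gamma_n)>T_n\}\to0.$$ All of these conclusions also hold with $\tau_{n,S,w}(\gamma_n)$ in place of 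$\tau_{n,Z,w}(\gamma_n)$.
   Context: Data: $(T_n)_{n\ge1}$ is an increasing sequence of positive integers with $T_n\to\infty$; $P_0,P_1$ are probability measures on $\mathbb R$. For each $n$, the row $(X_{n,j})_{j\ge1}$ satisfies $X_{n,1},\dots,X_{n,T_n}\stackrel{iid}{\sim}P_0$, $X_{n,T_n+1},X_{n,T_n+2},\dots\stackrel{iid}{\sim}P_1$, the two blocks being independent; randomizers $\lambda_{n,j}\stackrel{iid}{\sim}U(0,1)$ are independent of the array. $\mathbb P_{P_0,T_n,P_1}$ is the law of row $n$ together with its randomizers. Conformal p-values: $p_{n,j}:=\frac1j\big(\sum_{i=1}^j\mathbf 1\{X_{n,i}<X_{n,j}\}+\lambda_{n,j}\sum_{i=1}^j\mathbf 1\{X_{n,i}=X_{n,j}\}\big)$. Detectors: $\mathcal F=\{f_\theta:\theta\in\Theta\}$ is a jointly measurable family of probability densities on $[0,1]$, $\Pi$ a probability measure on $\Theta$. For $k\le t$, $M_{n,k,t}:=\int_\Theta\prod_{j=k}^t f_\theta(p_{n,j})\,d\Pi(\theta)$, $S_{n,t}^{(w)}:=\sum_{k=1}^tw_kM_{n,k,t}$, $Z_{n,t}^{(w)}:=\max_{1\le k\le t}w_kM_{n,k,t}$, $\tau_{n,S,w}(b):=\inf\{t\ge1:S_{n,t}^{(w)}\ge b\}$, $\tau_{n,Z,w}(b):=\inf\{t\ge1:Z_{n,t}^{(w)}\ge b\}$ ($\inf\varnothing=\infty$). $F_{P_0}$ is the CDF of $P_0$ and $H(t):=\mathbb P_{Y\sim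 P_1}\{F_{P_0}(Y)\le t\}$, $t\in[0,1]$. $H$ also denotes the law with this CDF, and $U$ is the uniform law on $[0,1]$. *)

theory Defs
  imports "HOL-Probability.Probability"
begin

definition unif :: "real measure" where
  "unif = uniform_measure lborel {0..1}"

text \<open>A sample point is a pair of the observations and the randomizers, both indexed by
  \<open>j \<ge> 1\<close>; \<open>T\<close> is the last pre-change time.\<close>

definition row_law ::
    "real measure \<Rightarrow> nat \<Rightarrow> real measure \<Rightarrow> ((nat \<Rightarrow> real) \<times> (nat \<Rightarrow> real)) measure" where
  "row_law P0 T P1 =
     (\<Pi>\<^sub>M j\<in>{1..}. if j \<le> T then P0 else P1) \<Otimes>\<^sub>M (\<Pi>\<^sub>M j\<in>{1..}. unif)"

definition conf_pval :: "(nat \<Rightarrow> real) \<times> (nat \<Rightarrow> real) \<Rightarrow> nat \<Rightarrow> real" where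
  "conf_pval \<omega> j = (case \<omega> of (x, l) \<Rightarrow>
     ((\<Sum>i=1..j. of_bool (x i < x j)) + l j * (\<Sum>i=1..j. of_bool (x i = x j))) / real j)"

text \<open>A jointly measurable family of probability densities on \<open>[0,1]\<close>, indexed by the points of
  \<open>\<pi>\<close>. Each member is taken as a function on the reals, extended measurably beyond \<open>[0,1]\<close>;
  the extension is immaterial because p-values lie in \<open>[0,1]\<close> almost surely.\<close>

definition density_family :: "'p measure \<Rightarrow> ('p \<Rightarrow> real \<Rightarrow> real) \<Rightarrow> bool" where
  "density_family \<pi> f \<longleftrightarrow>
     (\<lambda>(\<theta>, z). f \<theta> z) \<in> borel_measurable (\<pi> \<Otimes>\<^sub>M borel) \<and>
     (\<forall>\<theta>\<in>space \<pi>. (\<forall>z\<in>{0..1}. 0 \<le> f \<theta> z) \<and> (\<integral>\<^sup>+z\<in>{0..1}. ennreal (f \<theta> z) \<partial>lborel) = 1)"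

text \<open>The mixture integral may be infinite, so it and the statistics are extended reals.\<close>

definition mixture ::
    "('p \<Rightarrow> real \<Rightarrow> real) \<Rightarrow> 'p measure \<Rightarrow> (nat \<Rightarrow> real) \<Rightarrow> nat \<Rightarrow> nat \<Rightarrow> ennreal" where
  "mixture f \<pi> p k t = (\<integral>\<^sup>+\<theta>. ennreal (\<Prod>j=k..t. f \<theta> (p j)) \<partial>\<pi>)"

definition S_stat ::
    "('p \<Rightarrow> real \<Rightarrow> real) \<Rightarrow> 'p measure \<Rightarrow> (nat \<Rightarrow> real) \<Rightarrow> (nat \<Rightarrow> real) \<Rightarrow> nat \<Rightarrow> ennreal" where
  "S_stat f \<pi> w p t = (\<Sum>k=1..t. ennreal (w k) * mixture f \<pi> p k t)"

definition Z_stat ::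
    "('p \<Rightarrow> real \<Rightarrow> real) \<Rightarrow> 'p measure \<Rightarrow> (nat \<Rightarrow> real) \<Rightarrow> (nat \<Rightarrow> real) \<Rightarrow> nat \<Rightarrow> ennreal" where
  "Z_stat f \<pi> w p t = (MAX k\<in>{1..t}. ennreal (w k) * mixture f \<pi> p k t)"

definition first_passage :: "real \<Rightarrow> (nat \<Rightarrow> ennreal) \<Rightarrow> enat" where
  "first_passage b Y = Inf (enat ` {t. 1 \<le> t \<and> ennreal b \<le> Y t})"

definition tau_S ::
    "('p \<Rightarrow> real \<Rightarrow> real) \<Rightarrow> 'p measure \<Rightarrow> (nat \<Rightarrow> real) \<Rightarrow> real \<Rightarrow>
     (nat \<Rightarrow> real) \<times> (nat \<Rightarrow> real) \<Rightarrow> enat" where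
  "tau_S f \<pi> w b \<omega> = first_passage b (S_stat f \<pi> w (conf_pval \<omega>))"

definition tau_Z ::
    "('p \<Rightarrow> real \<Rightarrow> real) \<Rightarrow> 'p measure \<Rightarrow> (nat \<Rightarrow> real) \<Rightarrow> real \<Rightarrow>
     (nat \<Rightarrow> real) \<times> (nat \<Rightarrow> real) \<Rightarrow> enat" where
  "tau_Z f \<pi> w b \<omega> = first_passage b (Z_stat f \<pi> w (conf_pval \<omega>))"

definition H_cdf :: "real measure \<Rightarrow> real measure \<Rightarrow> real \<Rightarrow> real" where
  "H_cdf P0 P1 t = \<P>(y in P1. cdf P0 y \<le> t)"

definition H_law :: "real measure \<Rightarrow> real measure \<Rightarrow> real measure" where
  "H_law P0 P1 = distr P1 borel (cdf P0)"

lemma cdf_H_law: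
  assumes "real_distribution P0" and "real_distribution P1"
  shows "cdf (H_law P0 P1) t = H_cdf P0 P1 t"
proof -
  interpret P0: real_distribution P0 by fact
  interpret P1: real_distribution P1 by fact
  have "mono (cdf P0)"
    by (simp add: mono_def P0.cdf_nondecreasing)
  then have "cdf P0 \<in> measurable P1 borel"
    using borel_measurable_mono by (simp add: measurable_def)
  then have "measure (distr P1 borel (cdf P0)) {..t} = measure P1 {y. cdf P0 y \<le> t}"
    by (simp add: measure_distr vimage_def)
  then show ?thesis
    by (simp only: cdf_def[of "H_law P0 P1"]) (simp add: H_law_def H_cdf_def)
qed

definition ext_ln :: "ennreal \<Rightarrow> ereal" where
  "ext_ln x = (if x = 0 then - \<infinity> else if x = \<infinity> then \<infinity> else ereal (ln (enn2real x)))"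

end

theory Submission
  imports Defs "HOL-Real_Asymp.Real_Asymp"
begin

text \<open>Before the change the p-values are independent and uniform: given any symmetric function of the
  first \<open>n\<close> observations, exchangeability turns the \<open>n\<close>-th p-value into an average over all the
  ranks, which is uniform. Hence \<open>S t - t\<close> is a martingale on \<open>{1..T}\<close> for unit weights, and Doob's
  maximal inequality with mean \<open>T\<close> bounds the false alarms of \<open>S\<close>, hence also those of \<open>Z \<le> S\<close>.

  After the change it suffices to look at the window of length \<open>m = \<lfloor>A ln \<gamma>\<rfloor>\<close> started at \<open>T + 1\<close>.
  Since \<open>m = o(T)\<close>, Hoeffding's inequality for the \<open>T\<close> reference points and a union bound over the
  window put every p-value close to \<open>F(X j)\<close>, where \<open>F\<close> is the CDF of \<open>P0\<close>. By the Lipschitz property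
  of \<open>ln h\<close> and Hoeffding's inequality for \<open>ln h (F(X j))\<close>, the log-likelihood ratio over the window is
  about \<open>m * KL > ln \<gamma>\<close>, and the local support condition transfers this to the mixture up to a
  logarithmic loss.\<close>

subsection \<open>Law of the conformal p-values\<close>

text \<open>After the change the p-values are dependent and need not have law \<open>H\<close>; only
  the variables \<open>F (X j)\<close> are i.i.d. with law \<open>H\<close>, and KL is the mean of
  their log-density. Replacing one by the other costs \<open>\<epsilon>\<close> from the reference
  sample and \<open>m / T\<close> from window points that enter each other's ranks. The assumption
  \<open>ln \<gamma> = o(T)\<close> makes \<open>m / T\<close> and the union bound negligible; the
  slack \<open>A * KL - 1 > 0\<close> pays for \<open>\<epsilon>\<close>, the fluctuation of the
  log-likelihood, the rounding of \<open>m\<close> and the logarithmic loss. With unit weights the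
  window mixture lies below \<open>Z\<close> and hence below \<open>S\<close>, so it detects for
  both.

  Mixtures may be infinite and no filtration is set up: the false alarm bound is an
  \<open>ennreal\<close>-valued integral against a finite product of uniform laws, and conditional
  expectation becomes integration over the last coordinate. The densities are arbitrary, possibly
  negative, beyond \<open>[0, 1]\<close>, so the statistics are compared with these integrals only
  where all randomizers lie in \<open>[0, 1]\<close>.\<close>

lemma prob_space_unif: "prob_space unif"
  unfolding unif_def by (rule prob_space_uniform_measure) auto

lemma sets_unif [simp, measurable_cong]: "sets unif = sets borel"
  by (simp add: unif_def)

lemma space_unif [simp]: "space unif = UNIV"
  by (simp add: unif_def)

interpretation unif: prob_space unif
  by (rule prob_space_unif)

lemma nn_integral_unif:
  assumes [measurable]: "g \<in> borel_measurable borel"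
  shows "(\<integral>\<^sup>+z. g z \<partial>unif) = (\<integral>\<^sup>+z\<in>{0..1}. g z \<partial>lborel)"
  unfolding unif_def by (subst nn_integral_uniform_measure) (auto simp: divide_ennreal_def)

lemma AE_unif: "AE z in unif. z \<in> {0..1}"
  unfolding unif_def by (rule AE_uniform_measureI) auto

text \<open>The factor \<open>d\<close> stays on the left: a block of \<open>d\<close> tied points
  contributes \<open>d\<close> equal integrals, which together spread one uniform randomizer over
  \<open>{s..s + d}\<close>.\<close>

lemma nn_integral_unif_affine:
  fixes g :: "real \<Rightarrow> ennreal"
  assumes [measurable]: "g \<in> borel_measurable borel" and d: "0 < d"
  shows "ennreal d * (\<integral>\<^sup>+l. g (s + l * d) \<partial>unif) = (\<integral>\<^sup>+z\<in>{s..s + d}. g z \<partial>lborel)"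
proof -
  have *: "indicator {s..s + d} (s + l * d) = (indicator {0..1} l :: ennreal)" for l
    using d by (auto simp: indicator_def mult_le_cancel_right1 zero_le_mult_iff)
  have "(\<integral>\<^sup>+z\<in>{s..s + d}. g z \<partial>lborel)
      = ennreal \<bar>d\<bar> * (\<integral>\<^sup>+l. g (s + d * l) * indicator {s..s + d} (s + d * l) \<partial>lborel)"
    using d by (intro nn_integral_real_affine) auto
  also have "\<dots> = ennreal d * (\<integral>\<^sup>+l. g (s + l * d) \<partial>unif)"
    using d by (simp add: nn_integral_unif mult.commute[of d] *)
  finally show ?thesis ..
qed

text \<open>Ties among the \<open>x i\<close> are allowed: a block of \<open>q\<close> tied points above \<open>s\<close> smaller ones contributes
  the integral over \<open>[s, s + q]\<close>, so the blocks tile \<open>[0, card I]\<close>.\<close>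

lemma sum_rank_integral:
  fixes x :: "'i \<Rightarrow> real" and g :: "real \<Rightarrow> ennreal"
  assumes "finite I" and [measurable]: "g \<in> borel_measurable borel"
  shows "(\<Sum>i\<in>I. \<integral>\<^sup>+l. g (real (card {k\<in>I. x k < x i}) + l * real (card {k\<in>I. x k = x i})) \<partial>unif)
    = (\<integral>\<^sup>+z\<in>{0..real (card I)}. g z \<partial>lborel)"
  using assms(1)
proof (induction I rule: finite_psubset_induct)
  case (psubset I)
  show ?case
  proof (cases "I = {}")
    case True
    have "(\<integral>\<^sup>+z\<in>{0..0::real}. g z \<partial>lborel) = 0"
      by (subst nn_integral_cong_AE[of _ "\<lambda>_. 0"])
         (auto intro: AE_mp[OF AE_lborel_singleton[of 0]])
    then show ?thesis using True by simp
  next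
    case False
    \<comment> \<open>Split off the whole block of points tied at the maximum. No removed point lies
      at or below a remaining one, so the counts of the remaining points do not change when
      \<open>I\<close> shrinks to \<open>?I\<close>.\<close>
    define m where "m = Max (x ` I)"
    define J where "J = {i\<in>I. x i = m}"
    let ?I = "I - J"
    have fin: "finite I" "finite J" "finite ?I" using psubset by (auto simp: J_def)
    have m: "x i \<le> m" if "i \<in> I" for i using that fin by (auto simp: m_def)
    have "m \<in> x ` I" using fin False by (auto simp: m_def)
    then have J: "J \<noteq> {}" by (auto simp: J_def)
    then have sub: "?I \<subset> I" by (auto simp: J_def)
    have JI: "J \<subseteq> I" by (auto simp: J_def)
    have cJ: "0 < card J" using J fin by (simp add: card_gt_0_iff)
    have cI: "card I = card ?I + card J"
      using fin by (subst card_Un_disjoint[symmetric]) (auto simp: J_def intro!: arg_cong[of _ _ card])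
    have A: "(\<Sum>i\<in>J. \<integral>\<^sup>+l. g (real (card {k\<in>I. x k < x i}) + l * real (card {k\<in>I. x k = x i})) \<partial>unif)
       = (\<integral>\<^sup>+z\<in>{real (card ?I)..real (card I)}. g z \<partial>lborel)" (is "?l = ?r")
    proof -
      have "?l = (\<Sum>i\<in>J. \<integral>\<^sup>+l. g (real (card ?I) + l * real (card J)) \<partial>unif)"
      proof (intro sum.cong refl)
        fix i assume i: "i \<in> J"
        have "{k\<in>I. x k < x i} = ?I" "{k\<in>I. x k = x i} = J"
          using i m by (force simp: J_def)+
        then show "(\<integral>\<^sup>+l. g (real (card {k\<in>I. x k < x i}) + l * real (card {k\<in>I. x k = x i})) \<partial>unif)
          = (\<integral>\<^sup>+l. g (real (card ?I) + l * real (card J)) \<partial>unif)" by simp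
      qed
      also have "\<dots> = ennreal (card J) * (\<integral>\<^sup>+l. g (real (card ?I) + l * real (card J)) \<partial>unif)"
        by (simp add: ennreal_of_nat_eq_real_of_nat)
      also have "\<dots> = ?r"
        using cJ by (subst nn_integral_unif_affine) (auto simp: cI)
      finally show ?thesis .
    qed
    have "(\<Sum>i\<in>?I. \<integral>\<^sup>+l. g (real (card {k\<in>I. x k < x i}) + l * real (card {k\<in>I. x k = x i})) \<partial>unif)
       = (\<Sum>i\<in>?I. \<integral>\<^sup>+l. g (real (card {k\<in>?I. x k < x i}) + l * real (card {k\<in>?I. x k = x i})) \<partial>unif)"
    proof (intro sum.cong refl)
      fix i assume i: "i \<in> ?I"
      then have "x i < m" using m[of i] by (auto simp: J_def)
      then have "{k\<in>I. x k < x i} = {k\<in>?I. x k < x i}" "{k\<in>I. x k = x i} = {k\<in>?I. x k = x i}"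
        by (auto simp: J_def)
      then show "(\<integral>\<^sup>+l. g (real (card {k\<in>I. x k < x i}) + l * real (card {k\<in>I. x k = x i})) \<partial>unif)
        = (\<integral>\<^sup>+l. g (real (card {k\<in>?I. x k < x i}) + l * real (card {k\<in>?I. x k = x i})) \<partial>unif)" by simp
    qed
    also have "\<dots> = (\<integral>\<^sup>+z\<in>{0..real (card ?I)}. g z \<partial>lborel)"
      by (rule psubset.IH[OF sub])
    finally have B: "(\<Sum>i\<in>?I. \<integral>\<^sup>+l. g (real (card {k\<in>I. x k < x i}) + l * real (card {k\<in>I. x k = x i})) \<partial>unif)
      = (\<integral>\<^sup>+z\<in>{0..real (card ?I)}. g z \<partial>lborel)" .
    have "(\<Sum>i\<in>I. \<integral>\<^sup>+l. g (real (card {k\<in>I. x k < x i}) + l * real (card {k\<in>I. x k = x i})) \<partial>unif)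
      = (\<integral>\<^sup>+z\<in>{0..real (card ?I)}. g z \<partial>lborel) + (\<integral>\<^sup>+z\<in>{real (card ?I)..real (card I)}. g z \<partial>lborel)"
      by (simp only: sum.subset_diff[OF JI fin(1)] A B)
    also have "\<dots> = (\<integral>\<^sup>+z. g z * indicator {0..real (card ?I)} z + g z * indicator {real (card ?I)..real (card I)} z \<partial>lborel)"
      by (rule nn_integral_add[symmetric]) auto
    \<comment> \<open>The two intervals share only the point \<open>card ?I\<close>, which has
      measure zero.\<close>
    also have "\<dots> = (\<integral>\<^sup>+z\<in>{0..real (card I)}. g z \<partial>lborel)"
      using cI by (intro nn_integral_cong_AE AE_I'[of "{real (card ?I)}"])
        (auto simp: null_sets_def split: split_indicator)
    finally show ?thesis .
  qed
qed

text \<open>The mean of \<open>g\<close> of a conformal p-value over its randomizer, with the test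
  index \<open>i\<close> decoupled from the sample size \<open>n\<close>. For \<open>i = n\<close>
  this is the p-value at time \<open>n\<close>; the other indices are what exchangeability compares
  it with.\<close>

definition rank_mean :: "nat \<Rightarrow> (real \<Rightarrow> ennreal) \<Rightarrow> (nat \<Rightarrow> real) \<Rightarrow> nat \<Rightarrow> ennreal" where
  "rank_mean n g x i = (\<integral>\<^sup>+l. g (((\<Sum>k=1..n. of_bool (x k < x i)) +
     l * (\<Sum>k=1..n. of_bool (x k = x i))) / real n) \<partial>unif)"

text \<open>An identity for each fixed \<open>x\<close>, ties included:
  \<open>sum_rank_integral\<close> tiles \<open>[0, n]\<close>, and dividing by \<open>n\<close>
  maps this onto \<open>[0, 1]\<close> at the cost of the factor \<open>n\<close>.\<close>

lemma sum_rank_mean: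
  assumes n: "1 \<le> n" and [measurable]: "g \<in> borel_measurable borel"
  shows "(\<Sum>i=1..n. rank_mean n g x i) = of_nat n * (\<integral>\<^sup>+z. g z \<partial>unif)"
proof -
  have count: "(\<Sum>k=1..n. of_bool (P k)) = real (card {k\<in>{1..n}. P k})" for P
    by (subst sum_of_bool_eq) (auto intro!: arg_cong[of _ _ card])
  have "(\<Sum>i=1..n. rank_mean n g x i)
    = (\<Sum>i=1..n. \<integral>\<^sup>+l. (\<lambda>s. g (s / real n)) (real (card {k\<in>{1..n}. x k < x i}) + l * real (card {k\<in>{1..n}. x k = x i})) \<partial>unif)"
    by (simp only: rank_mean_def count)
  also have "\<dots> = (\<integral>\<^sup>+z\<in>{0..0 + real n}. g (z / real n) \<partial>lborel)"
    by (subst sum_rank_integral) auto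
  also have "\<dots> = ennreal n * (\<integral>\<^sup>+l. g ((0 + l * real n) / real n) \<partial>unif)"
    using n by (subst nn_integral_unif_affine[symmetric]) auto
  also have "\<dots> = of_nat n * (\<integral>\<^sup>+z. g z \<partial>unif)"
    using n by (simp add: ennreal_of_nat_eq_real_of_nat)
  finally show ?thesis .
qed

lemma borel_measurable_of_bool [measurable]:
  assumes [measurable]: "Measurable.pred M P"
  shows "(\<lambda>x. of_bool (P x) :: real) \<in> borel_measurable M"
  unfolding of_bool_def by measurable

lemma measurable_rank_mean [measurable]:
  assumes [measurable]: "g \<in> borel_measurable borel" 
   "\<And>k. k \<in> {1..n} \<Longrightarrow> (\<lambda>x. X x k) \<in> borel_measurable M" "(\<lambda>x. X x i) \<in> borel_measurable M"
  shows "(\<lambda>x. rank_mean n g (X x) i) \<in> borel_measurable M"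
  unfolding rank_mean_def by measurable

text \<open>Both counts run over all of \<open>{1..n}\<close>, so permuting the data leaves them
  alone and moves only the observation that is tested.\<close>

lemma rank_mean_transpose:
  assumes "i \<in> {1..n}" "j \<in> {1..n}"
  shows "rank_mean n g (\<lambda>k. x (Transposition.transpose i j k)) m = rank_mean n g x (Transposition.transpose i j m)"
proof -
  have "bij_betw (Transposition.transpose i j) {1..n} {1..n}"
    using assms by (auto simp: bij_betw_def)
  note sum.reindex_bij_betw[OF this, of "\<lambda>k. of_bool (x k < y) :: real" for y]
    sum.reindex_bij_betw[OF this, of "\<lambda>k. of_bool (x k = y) :: real" for y]
  then show ?thesis
    by (simp only: rank_mean_def)
qed

lemma rank_mean_cong:
  "(\<And>k. k \<in> {1..n} \<Longrightarrow> x k = y k) \<Longrightarrow> i \<in> {1..n} \<Longrightarrow> rank_mean n g x i = rank_mean n g y i"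
proof -
  assume *: "\<And>k. k \<in> {1..n} \<Longrightarrow> x k = y k" "i \<in> {1..n}"
  then have "(\<Sum>k=1..n. of_bool (x k < x i) :: real) = (\<Sum>k=1..n. of_bool (y k < y i))"
    "(\<Sum>k=1..n. of_bool (x k = x i) :: real) = (\<Sum>k=1..n. of_bool (y k = y i))"
    by (auto intro!: sum.cong simp del: sum_of_bool_eq)
  then show ?thesis
    by (simp only: rank_mean_def)
qed

lemma nn_integral_PiM_transpose:
  assumes P: "prob_space P" and ij: "i \<in> I" "j \<in> I" and f: "f \<in> borel_measurable (Pi\<^sub>M I (\<lambda>_. P))"
  shows "(\<integral>\<^sup>+x. f (\<lambda>k. x (Transposition.transpose i j k)) \<partial>Pi\<^sub>M I (\<lambda>_. P)) = (\<integral>\<^sup>+x. f x \<partial>Pi\<^sub>M I (\<lambda>_. P))"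
proof -
  let ?\<sigma> = "Transposition.transpose i j"
  have \<sigma>: "?\<sigma> \<in> I \<rightarrow> I"
    using ij by (auto simp: Transposition.transpose_def)
  then have [measurable]: "(\<lambda>x. \<lambda>k\<in>I. x (?\<sigma> k)) \<in> measurable (Pi\<^sub>M I (\<lambda>_. P)) (Pi\<^sub>M I (\<lambda>_. P))"
    by (intro measurable_restrict measurable_component_singleton) auto
  have "distr (Pi\<^sub>M I (\<lambda>_. P)) (Pi\<^sub>M I (\<lambda>_. P)) (\<lambda>x. \<lambda>k\<in>I. x (?\<sigma> k)) = Pi\<^sub>M I (\<lambda>_. P)"
    using P \<sigma> by (intro distr_PiM_reindex) auto
  then have "(\<integral>\<^sup>+x. f x \<partial>Pi\<^sub>M I (\<lambda>_. P))
    = (\<integral>\<^sup>+x. f x \<partial>distr (Pi\<^sub>M I (\<lambda>_. P)) (Pi\<^sub>M I (\<lambda>_. P)) (\<lambda>x. \<lambda>k\<in>I. x (?\<sigma> k)))"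
    by simp
  also have "\<dots> = (\<integral>\<^sup>+x. f (\<lambda>k\<in>I. x (?\<sigma> k)) \<partial>Pi\<^sub>M I (\<lambda>_. P))"
    by (rule nn_integral_distr) (use f in measurable)
  also have "\<dots> = (\<integral>\<^sup>+x. f (\<lambda>k. x (?\<sigma> k)) \<partial>Pi\<^sub>M I (\<lambda>_. P))"
  proof (intro nn_integral_cong arg_cong[of _ _ f] ext)
    \<comment> \<open>Points of the product space are \<open>undefined\<close> off \<open>I\<close>
      and the transposition fixes those indices, so the restriction changes nothing.\<close>
    fix x k assume "x \<in> space (Pi\<^sub>M I (\<lambda>_. P))"
    then show "(\<lambda>k\<in>I. x (?\<sigma> k)) k = x (?\<sigma> k)"
      using ij by (auto simp: space_PiM PiE_def extensional_def Transposition.transpose_def)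
  qed
  finally show ?thesis ..
qed

text \<open>The symmetric weight \<open>W\<close> makes the induction work: for a fixed last observation, its rank is a
  symmetric function of the earlier ones and is absorbed into the weight.\<close>

lemma nn_integral_rank_mean_prod:
  fixes W :: "(nat \<Rightarrow> real) \<Rightarrow> ennreal"
  assumes P: "real_distribution P"
    and g: "\<And>j. g j \<in> borel_measurable borel"
    and W: "W \<in> borel_measurable (Pi\<^sub>M {1..n} (\<lambda>_. P))"
    and sym: "\<And>i j x. i \<in> {1..n} \<Longrightarrow> j \<in> {1..n} \<Longrightarrow> W (\<lambda>k. x (Transposition.transpose i j k)) = W x"
  shows "(\<integral>\<^sup>+x. W x * (\<Prod>j=1..n. rank_mean j (g j) x j) \<partial>Pi\<^sub>M {1..n} (\<lambda>_. P))
    = (\<integral>\<^sup>+x. W x \<partial>Pi\<^sub>M {1..n} (\<lambda>_. P)) * (\<Prod>j=1..n. \<integral>\<^sup>+z. g j z \<partial>unif)"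
  using W sym
proof (induction n arbitrary: W)
  case 0
  then show ?case by simp
next
  case (Suc n)
  interpret P: real_distribution P by fact
  interpret PP: product_prob_space "\<lambda>_::nat. P" UNIV by unfold_locales
  note [measurable] = g Suc.prems(1)
  let ?N = "Suc n"
  have sP [measurable_cong]: "sets P = sets borel" by simp
  have I: "{1..?N} = insert ?N {1..n}" by auto
  let ?M = "Pi\<^sub>M {1..?N} (\<lambda>_. P)" and ?M' = "Pi\<^sub>M {1..n} (\<lambda>_. P)"
  let ?R = "rank_mean ?N (g ?N)"
  let ?V = "\<lambda>y x. W (x(?N := y)) * ?R (x(?N := y)) ?N"
  have upd [measurable]: "(\<lambda>x. x(?N := y)) \<in> measurable ?M' ?M" for y
    unfolding I by (intro measurable_fun_upd[where J="{1..n}"]) auto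
  have Rm: "(\<lambda>x. rank_mean j (g j) x i) \<in> borel_measurable ?M" if "j \<le> ?N" "i \<in> {1..?N}" for i j
    using that by (intro measurable_rank_mean) auto
  have WR: "(\<lambda>x. W x * ?R x i) \<in> borel_measurable ?M" if "i \<in> {1..?N}" for i
    using Rm[OF order_refl that] by measurable
  have IH: "(\<integral>\<^sup>+x. ?V y x * (\<Prod>j=1..n. rank_mean j (g j) x j) \<partial>?M')
    = (\<integral>\<^sup>+x. ?V y x \<partial>?M') * (\<Prod>j=1..n. \<integral>\<^sup>+z. g j z \<partial>unif)" for y
  proof (rule Suc.IH)
    show "?V y \<in> borel_measurable ?M'"
      using measurable_compose[OF upd Rm] measurable_compose[OF upd Suc.prems(1)] by measurable
    \<comment> \<open>Transpositions within \<open>{1..n}\<close> fix \<open>?N\<close>, so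
      \<open>y\<close> keeps its place and its rank is unchanged: \<open>?V y\<close> inherits the
      symmetry of \<open>W\<close>.\<close>
    fix i j x assume ij: "i \<in> {1..n}" "j \<in> {1..n}"
    have e: "(\<lambda>k. x (Transposition.transpose i j k))(?N := y) = (\<lambda>k. (x(?N := y)) (Transposition.transpose i j k))"
      using ij by (auto simp: Transposition.transpose_def)
    have t: "Transposition.transpose i j ?N = ?N" using ij by (auto simp: Transposition.transpose_def)
    show "?V y (\<lambda>k. x (Transposition.transpose i j k)) = ?V y x"
      using ij Suc.prems(2)[of i j "x(?N := y)"] rank_mean_transpose[of i ?N j "g ?N" "x(?N := y)" ?N]
      unfolding e t by (simp del: fun_upd_apply)
  qed
  have prodm: "(\<lambda>x. \<Prod>j=1..?N. rank_mean j (g j) x j) \<in> borel_measurable ?M"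
    by (intro borel_measurable_prod_ennreal Rm) auto
  have "(\<integral>\<^sup>+x. W x * (\<Prod>j=1..?N. rank_mean j (g j) x j) \<partial>?M)
    = (\<integral>\<^sup>+y. \<integral>\<^sup>+x. W (x(?N := y)) * (\<Prod>j=1..?N. rank_mean j (g j) (x(?N := y)) j) \<partial>?M' \<partial>P)"
    using prodm Suc.prems(1) unfolding I
    by (intro PP.product_nn_integral_insert_rev) auto
  also have "\<dots> = (\<integral>\<^sup>+y. \<integral>\<^sup>+x. ?V y x * (\<Prod>j=1..n. rank_mean j (g j) x j) \<partial>?M' \<partial>P)"
  proof (intro nn_integral_cong)
    \<comment> \<open>Ranks at times up to \<open>n\<close> compare earlier observations only and do
      not see \<open>y\<close>; the factor \<open>j = ?N\<close> joins the weight.\<close>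
    fix x y
    have "(\<Prod>j=1..n. rank_mean j (g j) (x(?N := y)) j) = (\<Prod>j=1..n. rank_mean j (g j) x j)"
      by (intro prod.cong refl rank_mean_cong) auto
    then show "W (x(?N := y)) * (\<Prod>j=1..?N. rank_mean j (g j) (x(?N := y)) j)
      = ?V y x * (\<Prod>j=1..n. rank_mean j (g j) x j)"
      by (simp add: mult_ac)
  qed
  also have "\<dots> = (\<integral>\<^sup>+y. (\<integral>\<^sup>+x. ?V y x \<partial>?M') * (\<Prod>j=1..n. \<integral>\<^sup>+z. g j z \<partial>unif) \<partial>P)"
    by (simp only: IH)
  also have "\<dots> = (\<integral>\<^sup>+y. \<integral>\<^sup>+x. ?V y x \<partial>?M' \<partial>P) * (\<Prod>j=1..n. \<integral>\<^sup>+z. g j z \<partial>unif)"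
  proof (rule nn_integral_multc)
    have "(\<lambda>(y, x). x(?N := y)) \<in> measurable (P \<Otimes>\<^sub>M ?M') ?M"
      unfolding I by measurable
    then have "(\<lambda>z. (\<lambda>x. W x * ?R x ?N) ((\<lambda>(y, x). x(?N := y)) z)) \<in> borel_measurable (P \<Otimes>\<^sub>M ?M')"
      by (rule measurable_compose) (intro WR, simp)
    then have m: "(\<lambda>(y, x). ?V y x) \<in> borel_measurable (P \<Otimes>\<^sub>M ?M')"
      by (simp add: case_prod_beta')
    show "(\<lambda>y. \<integral>\<^sup>+x. ?V y x \<partial>?M') \<in> borel_measurable P"
      by (rule sigma_finite_measure.borel_measurable_nn_integral
          [OF prob_space_imp_sigma_finite[OF prob_space_PiM[OF P.prob_space_axioms]] m])
  qed
  also have "(\<integral>\<^sup>+y. \<integral>\<^sup>+x. ?V y x \<partial>?M' \<partial>P) = (\<integral>\<^sup>+x. W x * ?R x ?N \<partial>?M)"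
    using WR[of ?N] unfolding I
    by (intro PP.product_nn_integral_insert_rev[symmetric]) auto
  also have "\<dots> = (\<integral>\<^sup>+x. W x \<partial>?M) * (\<integral>\<^sup>+z. g ?N z \<partial>unif)"
  proof -
    \<comment> \<open>Swapping \<open>i\<close> with \<open>?N\<close> preserves the law and
      \<open>W\<close> and turns the last rank into the \<open>i\<close>-th, so all
      \<open>?N\<close> summands have the same integral, while \<open>sum_rank_mean\<close> gives
      their sum pointwise.\<close>
    have "(\<integral>\<^sup>+x. W x * ?R x i \<partial>?M) = (\<integral>\<^sup>+x. W x * ?R x ?N \<partial>?M)" if i: "i \<in> {1..?N}" for i
    proof -
      have "(\<integral>\<^sup>+x. W x * ?R x ?N \<partial>?M)
        = (\<integral>\<^sup>+x. W (\<lambda>k. x (Transposition.transpose i ?N k)) * ?R (\<lambda>k. x (Transposition.transpose i ?N k)) ?N \<partial>?M)"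
        using i WR[of ?N] by (intro nn_integral_PiM_transpose[symmetric] P.prob_space_axioms) auto
      also have "\<dots> = (\<integral>\<^sup>+x. W x * ?R x i \<partial>?M)"
        using i rank_mean_transpose[of i ?N ?N "g ?N" _ ?N] Suc.prems(2)[of i ?N] by simp
      finally show ?thesis ..
    qed
    then have "(\<Sum>i=1..?N. \<integral>\<^sup>+x. W x * ?R x i \<partial>?M) = (\<Sum>i=1..?N. \<integral>\<^sup>+x. W x * ?R x ?N \<partial>?M)"
      by (rule sum.cong[OF refl])
    then have "of_nat ?N * (\<integral>\<^sup>+x. W x * ?R x ?N \<partial>?M) = (\<Sum>i=1..?N. \<integral>\<^sup>+x. W x * ?R x i \<partial>?M)"
      by (simp only: sum_constant card_atLeastAtMost diff_Suc_1 add_0_right)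
    also have "\<dots> = (\<integral>\<^sup>+x. (\<Sum>i=1..?N. W x * ?R x i) \<partial>?M)"
      by (intro nn_integral_sum[symmetric] WR)
    also have "\<dots> = (\<integral>\<^sup>+x. of_nat ?N * (W x * (\<integral>\<^sup>+z. g ?N z \<partial>unif)) \<partial>?M)"
    proof (rule nn_integral_cong)
      fix x
      have "(\<Sum>i=1..?N. W x * ?R x i) = W x * (\<Sum>i=1..?N. ?R x i)"
        by (rule sum_distrib_left[symmetric])
      also have "\<dots> = W x * (of_nat ?N * (\<integral>\<^sup>+z. g ?N z \<partial>unif))"
        by (subst sum_rank_mean) (auto simp: g)
      finally show "(\<Sum>i=1..?N. W x * ?R x i) = of_nat ?N * (W x * (\<integral>\<^sup>+z. g ?N z \<partial>unif))"
        by (simp only: mult_ac)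
    qed
    also have "\<dots> = of_nat ?N * ((\<integral>\<^sup>+x. W x \<partial>?M) * (\<integral>\<^sup>+z. g ?N z \<partial>unif))"
      using Suc.prems(1) by (simp only: nn_integral_cmult nn_integral_multc borel_measurable_times_ennreal borel_measurable_const)
    finally show ?thesis
      unfolding ennreal_mult_cancel_left by (simp del: of_nat_Suc)
  qed
  finally show ?case
    by (simp add: mult_ac)
qed

section \<open>The row law and the joint law of its first \<open>T\<close> p-values\<close>

lemma sets_row_law [measurable_cong]:
  assumes "sets P0 = sets borel" "sets P1 = sets borel"
  shows "sets (row_law P0 T P1) = sets (Pi\<^sub>M {1..} (\<lambda>_. borel) \<Otimes>\<^sub>M Pi\<^sub>M {1..} (\<lambda>_. borel))"
  unfolding row_law_def using assms by (intro sets_pair_measure_cong sets_PiM_cong) auto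

lemma prob_space_row_law:
  assumes "prob_space P0" "prob_space P1"
  shows "prob_space (row_law P0 T P1)"
  unfolding row_law_def using assms
  by (intro prob_space_pair prob_space_PiM) (auto simp: prob_space_unif)

lemma measurable_conf_pval:
  assumes "1 \<le> j"
  shows "(\<lambda>\<omega>. conf_pval \<omega> j) \<in> borel_measurable (Pi\<^sub>M {1..} (\<lambda>_. borel) \<Otimes>\<^sub>M Pi\<^sub>M {1..} (\<lambda>_. borel))"
proof -
  let ?M = "Pi\<^sub>M {1::nat..} (\<lambda>_. borel :: real measure) \<Otimes>\<^sub>M Pi\<^sub>M {1::nat..} (\<lambda>_. borel :: real measure)"
  have [measurable]: "(\<lambda>\<omega>. fst \<omega> i) \<in> borel_measurable ?M" "(\<lambda>\<omega>. snd \<omega> i) \<in> borel_measurable ?M"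
    if "i \<in> {1..}" for i
    using that by measurable
  have j: "j \<in> {1..}"
    using assms by simp
  have "(\<lambda>\<omega>. of_bool (fst \<omega> i < fst \<omega> j) :: real) \<in> borel_measurable ?M"
    "(\<lambda>\<omega>. of_bool (fst \<omega> i = fst \<omega> j) :: real) \<in> borel_measurable ?M" if "i \<in> {1..j}" for i
  proof -
    have "i \<in> {1..}"
      using that by simp
    then show "(\<lambda>\<omega>. of_bool (fst \<omega> i < fst \<omega> j) :: real) \<in> borel_measurable ?M"
      "(\<lambda>\<omega>. of_bool (fst \<omega> i = fst \<omega> j) :: real) \<in> borel_measurable ?M"
      using j by measurable
  qed
  then show ?thesis
    unfolding conf_pval_def case_prod_beta' using j by measurable
qed

lemma (in product_prob_space) nn_integral_PiM_restrict:
  assumes "finite J" "J \<subseteq> I" and "f \<in> borel_measurable (Pi\<^sub>M J M)"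
  shows "(\<integral>\<^sup>+x. f (restrict x J) \<partial>Pi\<^sub>M I M) = (\<integral>\<^sup>+x. f x \<partial>Pi\<^sub>M J M)"
  using assms by (subst distr_PiM_restrict_finite[of J, symmetric])
    (auto intro!: nn_integral_distr[symmetric] measurable_restrict_subset)

text \<open>Product sets determine the law. For fixed observations the \<open>j\<close>-th p-value
  uses only the randomizer \<open>l j\<close>, so integrating out the randomizers turns the product
  of indicators into a product of rank means, which \<open>nn_integral_rank_mean_prod\<close>
  evaluates with weight 1. Up to time \<open>T\<close> all observations have law
  \<open>P0\<close>.\<close>

lemma distr_conf_pval:
  assumes P0: "real_distribution P0" and P1: "real_distribution P1"
  shows "distr (row_law P0 T P1) (Pi\<^sub>M {1..T} (\<lambda>_. unif)) (\<lambda>\<omega>. \<lambda>j\<in>{1..T}. conf_pval \<omega> j)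
    = Pi\<^sub>M {1..T} (\<lambda>_. unif)"
proof -
  interpret P0: real_distribution P0 by fact
  interpret P1: real_distribution P1 by fact
  let ?M = "\<lambda>j. if j \<le> T then P0 else P1"
  interpret M: product_prob_space ?M "{1..}"
    by (auto simp: product_prob_space_def product_sigma_finite_def product_prob_space_axioms_def
      intro: prob_space_imp_sigma_finite P0.prob_space_axioms P1.prob_space_axioms)
  interpret U: product_prob_space "\<lambda>_::nat. unif" "{1..}"
    by unfold_locales
  interpret R: prob_space "row_law P0 T P1"
    by (intro prob_space_row_law P0.prob_space_axioms P1.prob_space_axioms)
  have pm: "(\<lambda>\<omega>. conf_pval \<omega> j) \<in> borel_measurable (row_law P0 T P1)" if "1 \<le> j" for j
    using measurable_conf_pval[OF that] by (simp add: measurable_cong_sets[OF sets_row_law])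
  have pm': "(\<lambda>\<omega>. \<lambda>j\<in>{1..T}. conf_pval \<omega> j) \<in> measurable (row_law P0 T P1) (Pi\<^sub>M {1..T} (\<lambda>_. unif))"
    using pm by (intro measurable_restrict) (simp add: measurable_cong_sets[OF refl sets_unif])
  show ?thesis
  proof (rule U.PiM_eqI)
    fix A :: "nat \<Rightarrow> real set" assume "\<And>j. j \<in> {1..T} \<Longrightarrow> A j \<in> sets unif"
    then have A: "A j \<in> sets borel" if "j \<in> {1..T}" for j using that by simp
    \<comment> \<open>\<open>A j\<close> is known to be measurable only for \<open>j\<close> in
      \<open>{1..T}\<close>; the default 0 elsewhere makes every \<open>g j\<close>
      measurable.\<close>
    define g where "g j = (if j \<in> {1..T} then indicator (A j) else (\<lambda>_. 0) :: real \<Rightarrow> ennreal)" for j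
    have g [measurable]: "g j \<in> borel_measurable borel" for j
      using A[of j] by (auto simp: g_def)
    have gm: "(\<lambda>\<omega>. \<Prod>j=1..T. g j (conf_pval \<omega> j)) \<in> borel_measurable (row_law P0 T P1)"
      using pm by (intro borel_measurable_prod_ennreal measurable_compose[OF pm g]) auto
    have "emeasure (distr (row_law P0 T P1) (Pi\<^sub>M {1..T} (\<lambda>_. unif)) (\<lambda>\<omega>. \<lambda>j\<in>{1..T}. conf_pval \<omega> j)) (Pi\<^sub>E {1..T} A)
      = (\<integral>\<^sup>+u. indicator (Pi\<^sub>E {1..T} A) u \<partial>distr (row_law P0 T P1) (Pi\<^sub>M {1..T} (\<lambda>_. unif)) (\<lambda>\<omega>. \<lambda>j\<in>{1..T}. conf_pval \<omega> j))"
      using A by (intro nn_integral_indicator[symmetric]) (auto intro!: sets_PiM_I_finite)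
    also have "\<dots> = (\<integral>\<^sup>+\<omega>. indicator (Pi\<^sub>E {1..T} A) (\<lambda>j\<in>{1..T}. conf_pval \<omega> j) \<partial>row_law P0 T P1)"
      using A by (intro nn_integral_distr pm' borel_measurable_indicator) (auto intro!: sets_PiM_I_finite)
    also have "\<dots> = (\<integral>\<^sup>+\<omega>. (\<Prod>j=1..T. g j (conf_pval \<omega> j)) \<partial>row_law P0 T P1)"
      by (intro nn_integral_cong) (auto simp: indicator_def g_def prod_eq_1_iff PiE_def Pi_def)
    also have "\<dots> = (\<integral>\<^sup>+x. \<integral>\<^sup>+l. (\<Prod>j=1..T. g j (conf_pval (x, l) j)) \<partial>Pi\<^sub>M {1..} (\<lambda>_. unif) \<partial>Pi\<^sub>M {1..} ?M)"
      using gm unfolding row_law_def by (rule sigma_finite_measure.nn_integral_fst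
          [OF prob_space_imp_sigma_finite[OF prob_space_PiM[OF prob_space_unif]], symmetric])
    also have "\<dots> = (\<integral>\<^sup>+x. (\<lambda>x. \<Prod>j=1..T. rank_mean j (g j) x j) (restrict x {1..T}) \<partial>Pi\<^sub>M {1..} ?M)"
    proof (intro nn_integral_cong)
      fix x :: "nat \<Rightarrow> real"
      let ?r = "\<lambda>j l. g j (((\<Sum>i=1..j. of_bool (x i < x j)) + l * (\<Sum>i=1..j. of_bool (x i = x j))) / real j)"
      have "(\<integral>\<^sup>+l. (\<Prod>j=1..T. g j (conf_pval (x, l) j)) \<partial>Pi\<^sub>M {1..} (\<lambda>_. unif))
        = (\<integral>\<^sup>+l. (\<lambda>l. \<Prod>j=1..T. ?r j (l j)) (restrict l {1..T}) \<partial>Pi\<^sub>M {1..} (\<lambda>_. unif))"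
        by (intro nn_integral_cong prod.cong refl) (simp add: conf_pval_def)
      also have "\<dots> = (\<integral>\<^sup>+l. (\<Prod>j=1..T. ?r j (l j)) \<partial>Pi\<^sub>M {1..T} (\<lambda>_. unif))"
        by (intro U.nn_integral_PiM_restrict) (auto intro!: borel_measurable_prod_ennreal measurable_compose[OF _ g])
      also have "\<dots> = (\<Prod>j=1..T. \<integral>\<^sup>+l. ?r j l \<partial>unif)"
        by (intro U.product_nn_integral_prod) auto
      also have "\<dots> = (\<Prod>j=1..T. rank_mean j (g j) (restrict x {1..T}) j)"
      proof (intro prod.cong refl)
        fix j assume j: "j \<in> {1..T}"
        have "(\<integral>\<^sup>+l. ?r j l \<partial>unif) = rank_mean j (g j) x j" by (simp only: rank_mean_def)
        also have "\<dots> = rank_mean j (g j) (restrict x {1..T}) j"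
          using j by (intro rank_mean_cong) auto
        finally show "(\<integral>\<^sup>+l. ?r j l \<partial>unif) = rank_mean j (g j) (restrict x {1..T}) j" .
      qed
      finally show "(\<integral>\<^sup>+l. (\<Prod>j=1..T. g j (conf_pval (x, l) j)) \<partial>Pi\<^sub>M {1..} (\<lambda>_. unif))
        = (\<Prod>j=1..T. rank_mean j (g j) (restrict x {1..T}) j)" .
    qed
    also have "\<dots> = (\<integral>\<^sup>+x. (\<Prod>j=1..T. rank_mean j (g j) x j) \<partial>Pi\<^sub>M {1..T} ?M)"
    proof (rule M.nn_integral_PiM_restrict)
      show "(\<lambda>x. \<Prod>j=1..T. rank_mean j (g j) x j) \<in> borel_measurable (Pi\<^sub>M {1..T} ?M)"
        by (intro borel_measurable_prod_ennreal measurable_rank_mean)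
          (auto simp: measurable_cong_sets[OF sets_PiM_cong[of _ _ ?M "\<lambda>_. borel"] refl])
    qed auto
    also have "Pi\<^sub>M {1..T} ?M = Pi\<^sub>M {1..T} (\<lambda>_. P0)"
      by (intro PiM_cong) auto
    also have "(\<integral>\<^sup>+x. (\<Prod>j=1..T. rank_mean j (g j) x j) \<partial>Pi\<^sub>M {1..T} (\<lambda>_. P0)) = (\<Prod>j=1..T. \<integral>\<^sup>+z. g j z \<partial>unif)"
      using nn_integral_rank_mean_prod[OF P0 g, of "\<lambda>_. 1" T]
        prob_space.emeasure_space_1[OF prob_space_PiM[of "{1..T}" "\<lambda>_. P0"]] P0.prob_space_axioms by simp
    also have "\<dots> = (\<Prod>j\<in>{1..T}. emeasure unif (A j))"
      using A by (intro prod.cong) (auto simp: g_def)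
    finally show "emeasure (distr (row_law P0 T P1) (Pi\<^sub>M {1..T} (\<lambda>_. unif)) (\<lambda>\<omega>. \<lambda>j\<in>{1..T}. conf_pval \<omega> j)) (Pi\<^sub>E {1..T} A)
      = (\<Prod>j\<in>{1..T}. emeasure unif (A j))" .
  qed auto
qed

lemma measurable_mixture_nn_integral:
  assumes "sigma_finite_measure \<pi>" and F: "(\<lambda>(\<theta>, z). F \<theta> z) \<in> borel_measurable (\<pi> \<Otimes>\<^sub>M borel)"
    and X: "\<And>j. j \<in> J \<Longrightarrow> (\<lambda>\<omega>. X \<omega> j) \<in> borel_measurable M"
  shows "(\<lambda>\<omega>. \<integral>\<^sup>+\<theta>. (\<Prod>j\<in>J. F \<theta> (X \<omega> j) :: ennreal) \<partial>\<pi>) \<in> borel_measurable M"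
proof -
  interpret sigma_finite_measure \<pi> by fact
  have "(\<lambda>z. F (snd z) (X (fst z) j)) \<in> borel_measurable (M \<Otimes>\<^sub>M \<pi>)" if "j \<in> J" for j
  proof -
    have [measurable]: "(\<lambda>\<omega>. X \<omega> j) \<in> borel_measurable M" using X that .
    have "(\<lambda>z. (snd z, X (fst z) j)) \<in> measurable (M \<Otimes>\<^sub>M \<pi>) (\<pi> \<Otimes>\<^sub>M borel)"
      by measurable
    from measurable_compose[OF this F] show ?thesis by simp
  qed
  then show ?thesis
    by (intro borel_measurable_nn_integral) (simp add: case_prod_beta')
qed

subsection \<open>Maximal inequality for the mixture statistic\<close>

text \<open>The densities enter as \<open>ennreal\<close>-valued functions integrated against
  \<open>unif\<close>. The product in \<open>mix\<close> is then taken in \<open>ennreal\<close>,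
  where Tonelli needs no integrability; it agrees with the real product in \<open>mixture\<close>
  wherever the densities are nonnegative.\<close>

locale density_mixture = prob_space \<pi> for \<pi> :: "'p measure" +
  fixes F :: "'p \<Rightarrow> real \<Rightarrow> ennreal"
  assumes F: "(\<lambda>(\<theta>, z). F \<theta> z) \<in> borel_measurable (\<pi> \<Otimes>\<^sub>M borel)"
    and F_int: "\<And>\<theta>. \<theta> \<in> space \<pi> \<Longrightarrow> (\<integral>\<^sup>+z. F \<theta> z \<partial>unif) = 1"
begin

definition mix :: "(nat \<Rightarrow> real) \<Rightarrow> nat \<Rightarrow> nat \<Rightarrow> ennreal" where
  "mix u k t = (\<integral>\<^sup>+\<theta>. (\<Prod>j=k..t. F \<theta> (u j)) \<partial>\<pi>)"

definition mix_sum :: "(nat \<Rightarrow> real) \<Rightarrow> nat \<Rightarrow> ennreal" where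
  "mix_sum u t = (\<Sum>k=1..t. mix u k t)"

lemma mix_sum_cong: "(\<And>j. j \<in> {1..t} \<Longrightarrow> u j = v j) \<Longrightarrow> mix_sum u t = mix_sum v t"
  unfolding mix_sum_def mix_def by (intro sum.cong nn_integral_cong prod.cong) auto

lemma measurable_mix_sum:
  assumes "{1..t} \<subseteq> J"
  shows "(\<lambda>u. mix_sum u t) \<in> borel_measurable (Pi\<^sub>M J (\<lambda>_. unif))"
proof -
  have "(\<lambda>u. u j) \<in> borel_measurable (Pi\<^sub>M J (\<lambda>_. unif))" if "j \<in> {1..t}" for j
    using measurable_component_singleton[of j J "\<lambda>_. unif"] that assms
    by (auto simp: measurable_cong_sets[OF refl sets_unif])
  then show ?thesis
    unfolding mix_sum_def mix_def
    by (intro borel_measurable_sum measurable_mixture_nn_integral F sigma_finite_measure_axioms) auto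
qed

text \<open>The martingale step without conditional expectations: the past is frozen in
  \<open>u\<close>, and by Tonelli the new factor integrates to 1 under each
  \<open>\<theta>\<close>. The case \<open>k = Suc t\<close> is included, where the product on the
  right-hand side is empty.\<close>

lemma nn_integral_mix_Suc:
  assumes k: "k \<le> Suc t"
  shows "(\<integral>\<^sup>+z. mix (u(Suc t := z)) k (Suc t) \<partial>unif) = mix u k t"
proof -
  interpret pair_sigma_finite \<pi> unif ..
  have Fc: "F \<theta> \<in> borel_measurable borel" if "\<theta> \<in> space \<pi>" for \<theta>
    using measurable_compose[OF measurable_Pair1'[OF that] F] by simp
  have Fr: "(\<lambda>\<theta>. F \<theta> y) \<in> borel_measurable \<pi>" for y
    using measurable_compose[OF measurable_Pair2'[of y borel \<pi>] F] by simp
  note [measurable] = F Fr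
  have pm: "(\<lambda>\<theta>. \<Prod>j=k..t. F \<theta> (u j)) \<in> borel_measurable \<pi>"
    by measurable
  have "(\<integral>\<^sup>+z. mix (u(Suc t := z)) k (Suc t) \<partial>unif)
    = (\<integral>\<^sup>+z. \<integral>\<^sup>+\<theta>. (\<Prod>j=k..t. F \<theta> (u j)) * F \<theta> z \<partial>\<pi> \<partial>unif)"
    unfolding mix_def
  proof (intro nn_integral_cong)
    fix \<theta> z
    have "(\<Prod>j=k..t. F \<theta> ((u(Suc t := z)) j)) = (\<Prod>j=k..t. F \<theta> (u j))"
      by (intro prod.cong) auto
    then show "(\<Prod>j=k..Suc t. F \<theta> ((u(Suc t := z)) j)) = (\<Prod>j=k..t. F \<theta> (u j)) * F \<theta> z"
      using k by (simp add: mult.commute)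
  qed
  also have "\<dots> = (\<integral>\<^sup>+\<theta>. \<integral>\<^sup>+z. (\<Prod>j=k..t. F \<theta> (u j)) * F \<theta> z \<partial>unif \<partial>\<pi>)"
  proof (rule Fubini')
    have "(\<lambda>z. (\<Prod>j=k..t. F (fst z) (u j)) * (case z of (\<theta>, z) \<Rightarrow> F \<theta> z)) \<in> borel_measurable (\<pi> \<Otimes>\<^sub>M unif)"
      using measurable_compose[OF measurable_fst pm, of unif] F
      by (intro borel_measurable_times_ennreal)
        (auto simp: measurable_cong_sets[OF sets_pair_measure_cong[OF refl sets_unif] refl])
    then show "(\<lambda>(\<theta>, z). (\<Prod>j=k..t. F \<theta> (u j)) * F \<theta> z) \<in> borel_measurable (\<pi> \<Otimes>\<^sub>M unif)"
      by (simp add: case_prod_beta')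
  qed
  also have "\<dots> = mix u k t"
    unfolding mix_def by (intro nn_integral_cong)
      (simp add: nn_integral_cmult F_int Fc measurable_cong_sets[OF sets_unif refl])
  finally show ?thesis .
qed

text \<open>The added 1 comes from the start \<open>k = Suc t\<close>, whose empty product has
  mixture mass 1; it is the increment of the compensator of \<open>mix_sum\<close>.\<close>

lemma nn_integral_mix_sum_Suc:
  "(\<integral>\<^sup>+z. mix_sum (u(Suc t := z)) (Suc t) \<partial>unif) = mix_sum u t + 1"
proof -
  have "(\<integral>\<^sup>+z. mix_sum (u(Suc t := z)) (Suc t) \<partial>unif)
    = (\<Sum>k=1..Suc t. \<integral>\<^sup>+z. mix (u(Suc t := z)) k (Suc t) \<partial>unif)"
    unfolding mix_sum_def mix_def
    by (intro nn_integral_sum measurable_mixture_nn_integral F sigma_finite_measure_axioms)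
      (auto simp: measurable_cong_sets[OF sets_unif refl])
  also have "\<dots> = (\<Sum>k=1..Suc t. mix u k t)"
    by (intro sum.cong nn_integral_mix_Suc) auto
  also have "\<dots> = mix_sum u t + mix u (Suc t) t"
    by (simp add: mix_sum_def)
  also have "mix u (Suc t) t = 1"
    by (simp add: mix_def emeasure_space_1)
  finally show ?thesis .
qed

text \<open>Doob's inequality by induction on the horizon. The indicator has to stay on the right:
  paths that crossed by time \<open>n\<close> are carried forward because \<open>mix_sum\<close>
  grows in conditional mean, and paths that first cross at \<open>Suc n\<close>, the event
  \<open>?D\<close>, satisfy \<open>c \<le> mix_sum\<close> there; the two events are disjoint, so
  the bounds add up.\<close>

lemma maximal_inequality_unif:
  "(\<integral>\<^sup>+u. mix_sum u n \<partial>Pi\<^sub>M {1..n} (\<lambda>_. unif)) = of_nat n"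
  "(\<integral>\<^sup>+u. c * of_bool (\<exists>t\<in>{1..n}. c \<le> mix_sum u t) \<partial>Pi\<^sub>M {1..n} (\<lambda>_. unif))
    \<le> (\<integral>\<^sup>+u. mix_sum u n * of_bool (\<exists>t\<in>{1..n}. c \<le> mix_sum u t) \<partial>Pi\<^sub>M {1..n} (\<lambda>_. unif))"
proof (induction n)
  case 0
  { case 1 then show ?case by (simp add: mix_sum_def) }
  { case 2 then show ?case by simp }
next
  case (Suc n)
  interpret U: product_prob_space "\<lambda>_::nat. unif" UNIV
    by unfold_locales
  interpret Un: prob_space "Pi\<^sub>M {1..n} (\<lambda>_::nat. unif)"
    by (intro prob_space_PiM prob_space_unif)
  let ?N = "Suc n"
  let ?M = "Pi\<^sub>M {1..n} (\<lambda>_::nat. unif)" and ?M' = "Pi\<^sub>M {1..?N} (\<lambda>_::nat. unif)"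
  let ?I = "\<lambda>n u. of_bool (\<exists>t\<in>{1..n}. c \<le> mix_sum u t) :: ennreal"
  let ?D = "\<lambda>u. of_bool (\<not> (\<exists>t\<in>{1..n}. c \<le> mix_sum u t) \<and> c \<le> mix_sum u ?N) :: ennreal"
  have ins: "{1..?N} = insert ?N {1..n}" by auto
  have m [measurable]: "(\<lambda>u. mix_sum u t) \<in> borel_measurable ?M'" if "t \<in> {1..?N}" for t
    using that by (intro measurable_mix_sum) auto
  have m' [measurable]: "(\<lambda>u. mix_sum u t) \<in> borel_measurable ?M" if "t \<in> {1..n}" for t
    using that by (intro measurable_mix_sum) auto
  have Im: "?I n \<in> borel_measurable ?M'" "?I n \<in> borel_measurable ?M" "?D \<in> borel_measurable ?M'"
    unfolding of_bool_def by measurable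
  \<comment> \<open>Crossing by time \<open>n\<close> is decided by the old coordinates, so its
    indicator comes out of the integral over the new one.\<close>
  have Iu: "?I n (u(?N := z)) = ?I n u" for u z
  proof -
    have "mix_sum (u(?N := z)) t = mix_sum u t" if "t \<in> {1..n}" for t
      using that by (intro mix_sum_cong) auto
    then show ?thesis by simp
  qed
  have um: "(\<lambda>z. mix_sum (u(?N := z)) ?N) \<in> borel_measurable unif" for u
    unfolding mix_sum_def mix_def
    by (intro borel_measurable_sum measurable_mixture_nn_integral F sigma_finite_measure_axioms)
      (auto simp: measurable_cong_sets[OF sets_unif refl])
  { case 1
    have "(\<integral>\<^sup>+u. mix_sum u ?N \<partial>?M') = (\<integral>\<^sup>+u. \<integral>\<^sup>+z. mix_sum (u(?N := z)) ?N \<partial>unif \<partial>?M)"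
      using m[of ?N] unfolding ins by (intro U.product_nn_integral_insert) auto
    also have "\<dots> = (\<integral>\<^sup>+u. mix_sum u n + 1 \<partial>?M)"
      by (simp only: nn_integral_mix_sum_Suc)
    also have "\<dots> = of_nat ?N"
      by (subst nn_integral_add) (auto intro!: measurable_mix_sum simp: Suc.IH[simplified] Un.emeasure_space_1[simplified])
    finally show ?case . }
  { case 2
    have "(\<integral>\<^sup>+u. c * ?I ?N u \<partial>?M') \<le> (\<integral>\<^sup>+u. c * ?I n u + mix_sum u ?N * ?D u \<partial>?M')"
    proof (intro nn_integral_mono)
      fix u
      show "c * ?I ?N u \<le> c * ?I n u + mix_sum u ?N * ?D u"
        by (auto simp: atLeastAtMostSuc_conv)
    qed
    also have "\<dots> = (\<integral>\<^sup>+u. c * ?I n u \<partial>?M') + (\<integral>\<^sup>+u. mix_sum u ?N * ?D u \<partial>?M')"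
      using Im m[of ?N] by (intro nn_integral_add borel_measurable_times_ennreal) auto
    also have "(\<integral>\<^sup>+u. c * ?I n u \<partial>?M') = (\<integral>\<^sup>+u. \<integral>\<^sup>+z. c * ?I n (u(?N := z)) \<partial>unif \<partial>?M)"
      using Im unfolding ins by (intro U.product_nn_integral_insert borel_measurable_times_ennreal) auto
    also have "\<dots> = (\<integral>\<^sup>+u. c * ?I n u \<partial>?M)"
      by (simp only: Iu nn_integral_const unif.emeasure_space_1 mult_1_right)
    also have "\<dots> \<le> (\<integral>\<^sup>+u. mix_sum u n * ?I n u \<partial>?M)"
      by (rule Suc.IH)
    also have "\<dots> \<le> (\<integral>\<^sup>+u. (mix_sum u n + 1) * ?I n u \<partial>?M)"
      by (intro nn_integral_mono mult_right_mono) auto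
    also have "\<dots> = (\<integral>\<^sup>+u. \<integral>\<^sup>+z. mix_sum (u(?N := z)) ?N * ?I n (u(?N := z)) \<partial>unif \<partial>?M)"
      by (simp only: Iu nn_integral_multc[OF um] nn_integral_mix_sum_Suc)
    also have "\<dots> = (\<integral>\<^sup>+u. mix_sum u ?N * ?I n u \<partial>?M')"
      using Im m[of ?N] unfolding ins
      by (intro U.product_nn_integral_insert[symmetric] borel_measurable_times_ennreal) auto
    also have "\<dots> + (\<integral>\<^sup>+u. mix_sum u ?N * ?D u \<partial>?M') = (\<integral>\<^sup>+u. mix_sum u ?N * ?I n u + mix_sum u ?N * ?D u \<partial>?M')"
      using Im m[of ?N] by (intro nn_integral_add[symmetric] borel_measurable_times_ennreal) auto
    also have "\<dots> = (\<integral>\<^sup>+u. mix_sum u ?N * ?I ?N u \<partial>?M')"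
      by (intro nn_integral_cong) (auto simp: atLeastAtMostSuc_conv)
    finally show ?case by (auto intro: add_mono) }
qed

text \<open>The event is decided by the first \<open>T\<close> p-values, so it can be measured under
  the product of uniform laws; the bound is the mean of \<open>mix_sum\<close> at \<open>T\<close>.
  The form without division covers every \<open>c\<close>, including 0 and infinity.\<close>

lemma false_alarm_bound:
  assumes P0: "real_distribution P0" and P1: "real_distribution P1"
  shows "c * emeasure (row_law P0 T P1) {\<omega>\<in>space (row_law P0 T P1). \<exists>t\<in>{1..T}. c \<le> mix_sum (conf_pval \<omega>) t}
    \<le> of_nat T"
proof -
  interpret P0: real_distribution P0 by fact
  interpret P1: real_distribution P1 by fact
  let ?U = "Pi\<^sub>M {1..T} (\<lambda>_::nat. unif)" and ?p = "\<lambda>\<omega>. \<lambda>j\<in>{1..T}. conf_pval \<omega> j"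
  let ?A = "{u\<in>space ?U. \<exists>t\<in>{1..T}. c \<le> mix_sum u t}"
  have m [measurable]: "(\<lambda>u. mix_sum u t) \<in> borel_measurable ?U" if "t \<in> {1..T}" for t
    using that by (intro measurable_mix_sum) auto
  have A: "?A \<in> sets ?U" by measurable
  have pm: "?p \<in> measurable (row_law P0 T P1) ?U"
    using measurable_conf_pval
    by (intro measurable_restrict) (simp add: measurable_cong_sets[OF sets_row_law sets_unif])
  have "{\<omega>\<in>space (row_law P0 T P1). \<exists>t\<in>{1..T}. c \<le> mix_sum (conf_pval \<omega>) t}
    = ?p -` ?A \<inter> space (row_law P0 T P1)"
  proof -
    have "mix_sum (?p \<omega>) t = mix_sum (conf_pval \<omega>) t" if "t \<in> {1..T}" for \<omega> t
      using that by (intro mix_sum_cong) auto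
    then show ?thesis
      using measurable_space[OF pm] by auto
  qed
  then have "c * emeasure (row_law P0 T P1) {\<omega>\<in>space (row_law P0 T P1). \<exists>t\<in>{1..T}. c \<le> mix_sum (conf_pval \<omega>) t}
    = c * emeasure (distr (row_law P0 T P1) ?U ?p) ?A"
    using emeasure_distr[OF pm A] by simp
  also have "\<dots> = c * emeasure ?U ?A"
    by (simp only: distr_conf_pval[OF P0 P1])
  also have "\<dots> = (\<integral>\<^sup>+u. c * indicator ?A u \<partial>?U)"
    using A by (rule nn_integral_cmult_indicator[symmetric])
  also have "\<dots> = (\<integral>\<^sup>+u. c * of_bool (\<exists>t\<in>{1..T}. c \<le> mix_sum u t) \<partial>?U)"
    by (intro nn_integral_cong) (auto simp: indicator_def)
  also have "\<dots> \<le> (\<integral>\<^sup>+u. mix_sum u T * of_bool (\<exists>t\<in>{1..T}. c \<le> mix_sum u t) \<partial>?U)"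
    by (rule maximal_inequality_unif)
  also have "\<dots> \<le> (\<integral>\<^sup>+u. mix_sum u T \<partial>?U)"
    by (intro nn_integral_mono) auto
  also have "\<dots> = of_nat T"
    by (rule maximal_inequality_unif)
  finally show ?thesis .
qed

end

subsection \<open>Deviation bounds after the change\<close>

lemma indep_vars_PiM:
  assumes I: "finite I" "I \<noteq> {}" and P: "prob_space P" and Y: "Y \<in> borel_measurable P"
  shows "prob_space.indep_vars (Pi\<^sub>M I (\<lambda>_. P)) (\<lambda>_. borel) (\<lambda>i x. Y (x i)) I"
proof -
  interpret prob_space "Pi\<^sub>M I (\<lambda>_. P)"
    by (intro prob_space_PiM P)
  have "indep_vars (\<lambda>_. P) (\<lambda>i x. x i) I"
  proof (subst indep_vars_iff_distr_eq_PiM'[OF I(2)])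
    have "distr (Pi\<^sub>M I (\<lambda>_. P)) (Pi\<^sub>M I (\<lambda>_. P)) (\<lambda>x. restrict x I) = distr (Pi\<^sub>M I (\<lambda>_. P)) (Pi\<^sub>M I (\<lambda>_. P)) (\<lambda>x. x)"
      by (intro distr_cong) (auto simp: space_PiM)
    also have "\<dots> = Pi\<^sub>M I (\<lambda>_. P)"
      by (rule distr_id)
    also have "\<dots> = Pi\<^sub>M I (\<lambda>i. distr (Pi\<^sub>M I (\<lambda>_. P)) P (\<lambda>x. x i))"
      by (intro PiM_cong refl distr_PiM_component[symmetric] P)
    finally show "distr (Pi\<^sub>M I (\<lambda>_. P)) (Pi\<^sub>M I (\<lambda>_. P)) (\<lambda>x. \<lambda>i\<in>I. x i)
      = Pi\<^sub>M I (\<lambda>i. distr (Pi\<^sub>M I (\<lambda>_. P)) P (\<lambda>x. x i))" .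
  qed auto
  then show ?thesis
    by (rule indep_vars_compose2) (use Y in simp)
qed

lemma Hoeffding_PiM:
  fixes Y :: "'a \<Rightarrow> real" and a b \<epsilon> :: real
  assumes I: "finite I" "I \<noteq> {}" and P: "prob_space P" and Y: "Y \<in> borel_measurable P"
    and ab: "\<And>y. a \<le> Y y" "\<And>y. Y y \<le> b" "a < b" and \<epsilon>: "0 \<le> \<epsilon>"
  shows "measure (Pi\<^sub>M I (\<lambda>_. P)) {x\<in>space (Pi\<^sub>M I (\<lambda>_. P)). \<epsilon> \<le> \<bar>(\<Sum>i\<in>I. Y (x i)) - card I * (\<integral>y. Y y \<partial>P)\<bar>}
    \<le> 2 * exp (-2 * \<epsilon>\<^sup>2 / (card I * (b - a)\<^sup>2))"
proof -
  interpret prob_space "Pi\<^sub>M I (\<lambda>_. P)"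
    by (intro prob_space_PiM P)
  interpret Hoeffding_ineq "Pi\<^sub>M I (\<lambda>_. P)" I "\<lambda>i x. Y (x i)" "\<lambda>_. a" "\<lambda>_. b" "\<Sum>i\<in>I. expectation (\<lambda>x. Y (x i))"
    by unfold_locales (use I ab indep_vars_PiM[OF I P Y] in auto)
  have "expectation (\<lambda>x. Y (x i)) = (\<integral>y. Y y \<partial>P)" if "i \<in> I" for i
  proof -
    have "(\<integral>y. Y y \<partial>P) = (\<integral>y. Y y \<partial>distr (Pi\<^sub>M I (\<lambda>_. P)) P (\<lambda>x. x i))"
      using distr_PiM_component[of I "\<lambda>_. P" i] P that by simp
    also have "\<dots> = expectation (\<lambda>x. Y (x i))"
      using Y that by (intro integral_distr) auto
    finally show ?thesis ..
  qed
  then have "(\<Sum>i\<in>I. expectation (\<lambda>x. Y (x i))) = card I * (\<integral>y. Y y \<partial>P)"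
    by simp
  moreover have "0 < card I * (b - a)\<^sup>2"
    using I ab by (simp add: card_gt_0_iff)
  ultimately show ?thesis
    using Hoeffding_ineq_abs_ge[OF \<epsilon>] by simp
qed

section \<open>Marginals of a row and the range of its p-values\<close>

lemma nn_integral_row_law_fst:
  assumes P: "prob_space P0" "prob_space P1" and J: "finite J" "J \<subseteq> {1..}"
    and f: "f \<in> borel_measurable (Pi\<^sub>M J (\<lambda>j. if j \<le> T then P0 else P1))"
  shows "(\<integral>\<^sup>+\<omega>. f (restrict (fst \<omega>) J) \<partial>row_law P0 T P1) = (\<integral>\<^sup>+x. f x \<partial>Pi\<^sub>M J (\<lambda>j. if j \<le> T then P0 else P1))"
proof -
  let ?M = "\<lambda>j. if j \<le> T then P0 else P1"
  interpret M: product_prob_space ?M "{1..}"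
    by (auto simp: product_prob_space_def product_sigma_finite_def product_prob_space_axioms_def
      intro: prob_space_imp_sigma_finite P)
  have R: "(\<lambda>x. restrict x J) \<in> measurable (Pi\<^sub>M {1..} ?M) (Pi\<^sub>M J ?M)"
    using J by (intro measurable_restrict_subset)
  have "(\<integral>\<^sup>+\<omega>. f (restrict (fst \<omega>) J) \<partial>row_law P0 T P1)
    = (\<integral>\<^sup>+x. \<integral>\<^sup>+l. f (restrict (fst (x, l)) J) \<partial>Pi\<^sub>M {1::nat..} (\<lambda>_. unif) \<partial>Pi\<^sub>M {1..} ?M)"
    unfolding row_law_def
    by (rule sigma_finite_measure.nn_integral_fst
          [OF prob_space_imp_sigma_finite[OF prob_space_PiM[OF prob_space_unif]], symmetric])
      (rule measurable_compose[OF measurable_compose[OF measurable_fst R] f])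
  also have "\<dots> = (\<integral>\<^sup>+x. f (restrict x J) \<partial>Pi\<^sub>M {1..} ?M)"
    using prob_space.emeasure_space_1[OF prob_space_PiM[of "{1::nat..}" "\<lambda>_. unif", OF prob_space_unif]]
    by simp
  also have "\<dots> = (\<integral>\<^sup>+x. f x \<partial>Pi\<^sub>M J ?M)"
    by (rule M.nn_integral_PiM_restrict[OF J f])
  finally show ?thesis .
qed

text \<open>\<open>unif\<close> is a measure on all of the reals, so a randomizer can leave
  \<open>[0, 1]\<close> on a null set, where p-values may leave it too and reach points at which
  \<open>f\<close> is unconstrained.\<close>

lemma AE_row_law_snd:
  assumes P: "prob_space P0" "prob_space P1"
  shows "AE \<omega> in row_law P0 T P1. \<forall>j\<in>{1..}. snd \<omega> j \<in> {0..1}"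
proof (intro AE_ball_countable')
  fix j :: nat assume j: "j \<in> {1..}"
  interpret pair_sigma_finite "Pi\<^sub>M {1..} (\<lambda>j. if j \<le> T then P0 else P1)" "Pi\<^sub>M {1::nat..} (\<lambda>_. unif)"
    using P by (intro pair_sigma_finite.intro prob_space_imp_sigma_finite prob_space_PiM prob_space_unif) auto
  have "AE l in Pi\<^sub>M {1..} (\<lambda>_. unif). l j \<in> {0..1}"
    using j by (intro AE_PiM_component prob_space_unif AE_unif)
  moreover have [measurable]: "(\<lambda>l. l j) \<in> borel_measurable (Pi\<^sub>M {1..} (\<lambda>_. unif))"
    using measurable_component_singleton[OF j, of "\<lambda>_. unif"]
    by (simp add: measurable_cong_sets[OF refl sets_unif])
  ultimately show "AE \<omega> in row_law P0 T P1. snd \<omega> j \<in> {0..1}"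
    unfolding row_law_def by (intro AE_pair_measure) auto
qed auto

lemma conf_pval_in_unit:
  assumes "snd \<omega> j \<in> {0..1}" "1 \<le> j"
  shows "conf_pval \<omega> j \<in> {0..1}"
proof -
  obtain x l where \<omega>: "\<omega> = (x, l)" by (cases \<omega>)
  let ?L = "\<Sum>i=1..j. of_bool (x i < x j) :: real" and ?E = "\<Sum>i=1..j. of_bool (x i = x j) :: real"
  have "?L + ?E = (\<Sum>i=1..j. of_bool (x i \<le> x j))"
    by (subst sum.distrib[symmetric]) (auto intro!: sum.cong simp del: sum_of_bool_eq)
  also have "\<dots> \<le> (\<Sum>i=1..j. 1)"
    by (intro sum_mono) auto
  finally have "?L + ?E \<le> j" by simp
  moreover have nn: "0 \<le> ?L" "0 \<le> ?E" by (intro sum_nonneg; simp)+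
  moreover have "l j * ?E \<le> 1 * ?E"
    using assms nn by (intro mult_right_mono) (auto simp: \<omega>)
  moreover have "0 \<le> l j * ?E"
    using assms nn by (intro mult_nonneg_nonneg) (auto simp: \<omega>)
  ultimately have "0 \<le> ?L + l j * ?E" "?L + l j * ?E \<le> j" by linarith+
  then show ?thesis
    using assms(2) by (simp add: conf_pval_def \<omega> divide_le_eq del: sum_of_bool_eq)
qed

text \<open>The strict and the weak count among the \<open>T\<close> reference points bracket the
  tie-broken count \<open>N\<close> for every value of the randomizer. The points
  \<open>T + 1, ..., j\<close>, with contribution \<open>R\<close>, number at most \<open>m\<close>
  and move the average by at most \<open>m / T\<close>, whatever their values.\<close>

lemma conf_pval_near_reference:
  fixes x l :: "nat \<Rightarrow> real" and F \<epsilon> :: real and T j m :: nat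
  assumes T: "1 \<le> T" and j: "j \<in> {T + 1..T + m}" and l: "l j \<in> {0..1}"
    and lt: "\<bar>(\<Sum>k=1..T. of_bool (x k < x j)) - T * F\<bar> < \<epsilon> * T"
    and le: "\<bar>(\<Sum>k=1..T. of_bool (x k \<le> x j)) - T * F\<bar> < \<epsilon> * T"
  shows "\<bar>conf_pval (x, l) j - F\<bar> \<le> \<epsilon> + m / T"
proof -
  define NL where "NL = (\<Sum>k=1..T. of_bool (x k < x j) :: real)"
  define NE where "NE = (\<Sum>k=1..T. of_bool (x k = x j) :: real)"
  define RL where "RL = (\<Sum>k=T+1..j. of_bool (x k < x j) :: real)"
  define RE where "RE = (\<Sum>k=T+1..j. of_bool (x k = x j) :: real)"
  define N where "N = NL + l j * NE"
  define R where "R = RL + l j * RE"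
  have split: "{1..j} = {1..T} \<union> {T+1..j}" "{1..T} \<inter> {T+1..j} = {}"
    using j by auto
  have sums: "(\<Sum>k=1..j. of_bool (x k < x j) :: real) = NL + RL" "(\<Sum>k=1..j. of_bool (x k = x j) :: real) = NE + RE"
    unfolding NL_def NE_def RL_def RE_def split(1) by (intro sum.union_disjoint split; simp)+
  have p: "conf_pval (x, l) j = (N + R) / j"
    unfolding conf_pval_def prod.case sums N_def R_def by (simp add: algebra_simps)
  have NLE: "NL + NE = (\<Sum>k=1..T. of_bool (x k \<le> x j))"
    unfolding NL_def NE_def
    by (subst sum.distrib[symmetric]) (auto intro!: sum.cong simp del: sum_of_bool_eq)
  have "RL + RE = (\<Sum>k=T+1..j. of_bool (x k \<le> x j))"
    unfolding RL_def RE_def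
    by (subst sum.distrib[symmetric]) (auto intro!: sum.cong simp del: sum_of_bool_eq)
  also have "\<dots> \<le> (\<Sum>k=T+1..j. 1)" by (intro sum_mono) auto
  also have "\<dots> = real j - T" using j by (simp add: of_nat_diff)
  finally have RR: "RL + RE \<le> real j - T" .
  have "(\<Sum>k=1..T. of_bool (x k \<le> x j)) \<le> (\<Sum>k=1..T. 1::real)" by (intro sum_mono) auto
  then have NT: "NL + NE \<le> T" by (simp add: NLE)
  have nn: "0 \<le> NL" "0 \<le> NE" "0 \<le> RL" "0 \<le> RE"
    unfolding NL_def NE_def RL_def RE_def by (intro sum_nonneg; simp)+
  have l': "0 \<le> l j * NE" "l j * NE \<le> NE" "0 \<le> l j * RE" "l j * RE \<le> RE"
    using l nn by (auto intro: mult_left_le_one_le)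
  have N: "NL \<le> N" "N \<le> NL + NE" "0 \<le> N" "N \<le> T" and R: "0 \<le> R" "R \<le> real j - T"
    using l' nn NT RR by (auto simp: N_def R_def)
  have "\<bar>N - T * F\<bar> \<le> \<epsilon> * T"
    using N lt le unfolding NL_def[symmetric] NLE[symmetric] by linarith
  then have 1: "\<bar>N / T - F\<bar> \<le> \<epsilon>"
    using T by (simp add: abs_le_iff field_simps)
  have jT: "0 < real j" "0 < real T" "real j - T \<le> m" "T \<le> real j" using j T by auto
  \<comment> \<open>Both \<open>R * T\<close> and \<open>(real j - T) * N\<close> lie between 0 and
    \<open>(real j - T) * T\<close>, so they differ by at most that bound.\<close>
  have "(real j - T) * N \<le> (real j - T) * T" "0 \<le> (real j - T) * N" "R * T \<le> (real j - T) * T" "0 \<le> R * T"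
    using N R jT by (auto intro!: mult_left_mono mult_right_mono mult_nonneg_nonneg)
  then have "\<bar>R * T - (real j - T) * N\<bar> \<le> (real j - T) * T" by linarith
  moreover have "(N + R) / j - N / T = (R * T - (real j - T) * N) / (j * T)"
    using jT by (simp add: field_simps)
  ultimately have "\<bar>(N + R) / j - N / T\<bar> \<le> (real j - T) * T / (j * T)"
    by (simp only: abs_divide abs_mult abs_of_nat) (intro divide_right_mono, auto)
  also have "\<dots> = (real j - T) / j" using jT by simp
  also have "\<dots> \<le> m / T" using jT by (intro frac_le) auto
  finally show ?thesis
    using 1 unfolding p by linarith
qed

text \<open>Given the value \<open>y\<close> of the \<open>j\<close>-th observation, which is
  independent of the reference sample, the count is a sum of \<open>T\<close> independent Bernoulli
  variables with mean \<open>cdf P0 y\<close>, and Hoeffding's bound does not depend on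
  \<open>y\<close>. A pointwise bound suffices, since the window has only \<open>m\<close> test
  points. \<open>R\<close> will be \<open><\<close> and \<open>\<le>\<close>.\<close>

lemma prob_rank_deviation:
  fixes R :: "real \<Rightarrow> real \<Rightarrow> bool" and \<epsilon> :: real
  assumes P0: "real_distribution P0" and P1: "real_distribution P1" and T: "1 \<le> T" and j: "T < j" and \<epsilon>: "0 < \<epsilon>"
    and R: "Measurable.pred (borel \<Otimes>\<^sub>M borel) (\<lambda>(x, y). R x y)"
    and RF: "\<And>y. measure P0 {x. R x y} = cdf P0 y"
  shows "measure (row_law P0 T P1) {\<omega>\<in>space (row_law P0 T P1).
      \<epsilon> * T \<le> \<bar>(\<Sum>k=1..T. of_bool (R (fst \<omega> k) (fst \<omega> j))) - T * cdf P0 (fst \<omega> j)\<bar>}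
    \<le> 2 * exp (-2 * \<epsilon>\<^sup>2 * T)"
proof -
  interpret P0: real_distribution P0 by fact
  interpret P1: real_distribution P1 by fact
  interpret row: prob_space "row_law P0 T P1"
    by (intro prob_space_row_law P0.prob_space_axioms P1.prob_space_axioms)
  let ?M = "\<lambda>j. if j \<le> T then P0 else P1"
  interpret M: product_prob_space ?M UNIV
    by (auto simp: product_prob_space_def product_sigma_finite_def product_prob_space_axioms_def
      intro: prob_space_imp_sigma_finite P0.prob_space_axioms P1.prob_space_axioms)
  let ?J = "insert j {1..T}"
  let ?Q = "\<lambda>x :: nat \<Rightarrow> real. \<epsilon> * T \<le> \<bar>(\<Sum>k=1..T. of_bool (R (x k) (x j))) - T * cdf P0 (x j)\<bar>"
  have cdf [measurable]: "cdf P0 \<in> borel_measurable borel"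
    by (intro borel_measurable_mono) (auto simp: mono_def P0.cdf_nondecreasing)
  have R': "Measurable.pred N (\<lambda>x. R (f x) (g x))"
    if "f \<in> borel_measurable N" "g \<in> borel_measurable N" for f g and N :: "'z measure"
    using measurable_compose[of "\<lambda>x. (f x, g x)" N "borel \<Otimes>\<^sub>M borel", OF measurable_Pair R] that by simp
  have restr: "?Q (restrict x ?J) = ?Q x" for x
  proof -
    have "(\<Sum>k=1..T. of_bool (R (restrict x ?J k) (x j)) :: real) = (\<Sum>k=1..T. of_bool (R (x k) (x j)))"
      by (intro sum.cong) auto
    moreover have "restrict x ?J j = x j"
      by simp
    ultimately show ?thesis
      by (simp only:)
  qed
  have QJ: "Measurable.pred N (\<lambda>z. ?Q (X z))"
    if "\<And>k. k \<in> ?J \<Longrightarrow> (\<lambda>z. X z k) \<in> borel_measurable N" for X and N :: "'z measure"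
  proof -
    have [measurable]: "(\<lambda>z. X z j) \<in> borel_measurable N" "\<And>k. k \<in> {1..T} \<Longrightarrow> (\<lambda>z. X z k) \<in> borel_measurable N"
      using that by auto
    note [measurable] = R'
    show ?thesis by measurable
  qed
  have Qm: "Measurable.pred (Pi\<^sub>M ?J ?M) ?Q"
    by (rule QJ) (auto simp: measurable_cong_sets[OF sets_PiM_cong[of _ _ ?M "\<lambda>_. borel"] refl])
  have Qr: "Measurable.pred (row_law P0 T P1) (\<lambda>\<omega>. ?Q (fst \<omega>))"
    using j by (intro QJ) (auto simp: measurable_cong_sets[OF sets_row_law refl]
        intro!: measurable_compose[OF measurable_fst] measurable_component_singleton)
  have "emeasure (row_law P0 T P1) {\<omega>\<in>space (row_law P0 T P1). ?Q (fst \<omega>)}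
    = (\<integral>\<^sup>+\<omega>. indicator {\<omega>\<in>space (row_law P0 T P1). ?Q (fst \<omega>)} \<omega> \<partial>row_law P0 T P1)"
    using Qr by (intro nn_integral_indicator[symmetric]) auto
  also have "\<dots> = (\<integral>\<^sup>+\<omega>. (\<lambda>x. of_bool (?Q x)) (restrict (fst \<omega>) ?J) \<partial>row_law P0 T P1)"
    by (intro nn_integral_cong) (simp only: restr indicator_def mem_Collect_eq, simp)
  also have "\<dots> = (\<integral>\<^sup>+x. of_bool (?Q x) \<partial>Pi\<^sub>M ?J ?M)"
    using Qm j by (intro nn_integral_row_law_fst P0.prob_space_axioms P1.prob_space_axioms)
      (auto simp: of_bool_def)
  also have "\<dots> = (\<integral>\<^sup>+y. \<integral>\<^sup>+x. of_bool (?Q (x(j := y))) \<partial>Pi\<^sub>M {1..T} ?M \<partial>?M j)"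
    using Qm j by (intro M.product_nn_integral_insert_rev) (auto simp: of_bool_def)
  also have "\<dots> \<le> (\<integral>\<^sup>+y. ennreal (2 * exp (-2 * \<epsilon>\<^sup>2 * T)) \<partial>?M j)"
  proof (intro nn_integral_mono)
    fix y
    let ?PT = "Pi\<^sub>M {1..T} (\<lambda>_. P0)"
    interpret PT: prob_space ?PT
      by (intro prob_space_PiM P0.prob_space_axioms)
    let ?Y = "\<lambda>x. of_bool (R x y) :: real"
    let ?B = "{x\<in>space ?PT. \<epsilon> * T \<le> \<bar>(\<Sum>k\<in>{1..T}. ?Y (x k)) - card {1..T} * (\<integral>x. ?Y x \<partial>P0)\<bar>}"
    have Ym: "?Y \<in> borel_measurable P0"
      by (intro borel_measurable_of_bool R') auto
    have Y: "(\<integral>x. ?Y x \<partial>P0) = cdf P0 y"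
    proof -
      have "?Y = indicator {x. R x y}" by (auto simp: indicator_def)
      then show ?thesis using RF by simp
    qed
    have Bm: "?B \<in> sets ?PT"
      using Ym by measurable
    have PM: "Pi\<^sub>M {1..T} ?M = ?PT" by (intro PiM_cong) auto
    have "(\<integral>\<^sup>+x. of_bool (?Q (x(j := y))) \<partial>Pi\<^sub>M {1..T} ?M) = (\<integral>\<^sup>+x. indicator ?B x \<partial>?PT)"
      unfolding PM
    proof (intro nn_integral_cong)
      fix x assume x: "x \<in> space ?PT"
      have "(\<Sum>k=1..T. of_bool (R ((x(j := y)) k) y) :: real) = (\<Sum>k=1..T. ?Y (x k))"
        using j by (intro sum.cong) auto
      then have "?Q (x(j := y)) \<longleftrightarrow> x \<in> ?B"
        using x by (simp only: Y fun_upd_same mem_Collect_eq simp_thms card_atLeastAtMost diff_Suc_1)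
      then show "of_bool (?Q (x(j := y))) = (indicator ?B x :: ennreal)"
        by (simp only: indicator_def)
    qed
    also have "\<dots> = ennreal (PT.prob ?B)"
      unfolding nn_integral_indicator[OF Bm] by (rule PT.emeasure_eq_measure)
    also have "\<dots> \<le> ennreal (2 * exp (-2 * (\<epsilon> * T)\<^sup>2 / (real (card {1..T}) * (1 - 0)\<^sup>2)))"
      using T \<epsilon> Ym P0.prob_space_axioms
      by (intro ennreal_leI Hoeffding_PiM[of "{1..T}" P0 ?Y 0 1 "\<epsilon> * T"]) (simp_all del: sum_of_bool_eq)
    also have "-2 * (\<epsilon> * T)\<^sup>2 / (real (card {1..T}) * (1 - 0)\<^sup>2) = -2 * \<epsilon>\<^sup>2 * T"
      using T by (simp add: power2_eq_square)
    finally show "(\<integral>\<^sup>+x. of_bool (?Q (x(j := y))) \<partial>Pi\<^sub>M {1..T} ?M) \<le> ennreal (2 * exp (-2 * \<epsilon>\<^sup>2 * T))" .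
  qed
  also have "\<dots> = ennreal (2 * exp (-2 * \<epsilon>\<^sup>2 * T))"
    using P0.emeasure_space_1 P1.emeasure_space_1 by simp
  finally show ?thesis
    by (simp add: row.emeasure_eq_measure)
qed

text \<open>Applied to \<open>\<psi> y = ln (h (cdf P0 y))\<close>, whose mean under
  \<open>P1\<close> is the divergence. \<open>2 * B\<close> is the length of the range
  \<open>[-B, B]\<close> in Hoeffding's exponent.\<close>

lemma prob_post_change_deviation:
  fixes \<psi> :: "real \<Rightarrow> real" and \<delta> B :: real
  assumes P0: "real_distribution P0" and P1: "real_distribution P1" and m: "1 \<le> m" and \<delta>: "0 \<le> \<delta>"
    and \<psi> [measurable]: "\<psi> \<in> borel_measurable borel" and B: "0 < B" "\<And>y. \<bar>\<psi> y\<bar> \<le> B"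
  shows "measure (row_law P0 T P1) {\<omega>\<in>space (row_law P0 T P1).
      \<delta> * m \<le> \<bar>(\<Sum>j=T+1..T+m. \<psi> (fst \<omega> j)) - m * (\<integral>y. \<psi> y \<partial>P1)\<bar>}
    \<le> 2 * exp (-2 * \<delta>\<^sup>2 * m / (2 * B)\<^sup>2)"
proof -
  interpret P0: real_distribution P0 by fact
  interpret P1: real_distribution P1 by fact
  interpret row: prob_space "row_law P0 T P1"
    by (intro prob_space_row_law P0.prob_space_axioms P1.prob_space_axioms)
  let ?M = "\<lambda>j. if j \<le> T then P0 else P1"
  let ?J = "{T+1..T+m}"
  let ?PJ = "Pi\<^sub>M ?J (\<lambda>_. P1)"
  interpret PJ: prob_space ?PJ
    by (intro prob_space_PiM P1.prob_space_axioms)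
  let ?Q = "\<lambda>x. \<delta> * m \<le> \<bar>(\<Sum>j\<in>?J. \<psi> (x j)) - card ?J * (\<integral>y. \<psi> y \<partial>P1)\<bar>"
  have restr: "?Q (restrict x ?J) = ?Q x" for x
  proof -
    have "(\<Sum>j\<in>?J. \<psi> (restrict x ?J j)) = (\<Sum>j\<in>?J. \<psi> (x j))"
      by (intro sum.cong) auto
    then show ?thesis
      by (simp only:)
  qed
  have PM: "Pi\<^sub>M ?J ?M = ?PJ" by (intro PiM_cong) auto
  have Qm [measurable]: "Measurable.pred ?PJ ?Q" by measurable
  have Qr: "Measurable.pred (row_law P0 T P1) (\<lambda>\<omega>. ?Q (fst \<omega>))"
  proof -
    have [measurable]: "(\<lambda>\<omega>. fst \<omega> j) \<in> borel_measurable (row_law P0 T P1)" if "j \<in> ?J" for j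
      using that by (auto simp: measurable_cong_sets[OF sets_row_law refl]
        intro!: measurable_compose[OF measurable_fst] measurable_component_singleton)
    show ?thesis by measurable
  qed
  have "emeasure (row_law P0 T P1) {\<omega>\<in>space (row_law P0 T P1). ?Q (fst \<omega>)}
    = (\<integral>\<^sup>+\<omega>. indicator {\<omega>\<in>space (row_law P0 T P1). ?Q (fst \<omega>)} \<omega> \<partial>row_law P0 T P1)"
    using Qr by (intro nn_integral_indicator[symmetric]) auto
  also have "\<dots> = (\<integral>\<^sup>+\<omega>. (\<lambda>x. of_bool (?Q x)) (restrict (fst \<omega>) ?J) \<partial>row_law P0 T P1)"
    by (intro nn_integral_cong) (simp only: restr indicator_def mem_Collect_eq, simp)
  also have "\<dots> = (\<integral>\<^sup>+x. of_bool (?Q x) \<partial>?PJ)"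
    using Qm unfolding PM[symmetric]
    by (intro nn_integral_row_law_fst P0.prob_space_axioms P1.prob_space_axioms) (auto simp: of_bool_def)
  also have "\<dots> = (\<integral>\<^sup>+x. indicator {x\<in>space ?PJ. ?Q x} x \<partial>?PJ)"
    by (intro nn_integral_cong) (auto simp: indicator_def)
  also have "\<dots> = emeasure ?PJ {x\<in>space ?PJ. ?Q x}"
    using Qm by (intro nn_integral_indicator) auto
  also have "\<dots> = ennreal (PJ.prob {x\<in>space ?PJ. ?Q x})"
    by (rule PJ.emeasure_eq_measure)
  finally have "row.prob {\<omega>\<in>space (row_law P0 T P1). ?Q (fst \<omega>)} = PJ.prob {x\<in>space ?PJ. ?Q x}"
    by (simp add: row.emeasure_eq_measure)
  also have "\<dots> \<le> 2 * exp (-2 * (\<delta> * m)\<^sup>2 / (card ?J * (B - - B)\<^sup>2))"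
    using m \<delta> B abs_le_D1[OF B(2)] abs_le_D2[OF B(2)] P1.prob_space_axioms \<psi>
    by (intro Hoeffding_PiM[where I = ?J and a = "- B" and b = B and \<epsilon> = "\<delta> * m"]) (simp_all add: minus_le_iff)
  also have "-2 * (\<delta> * m)\<^sup>2 / (card ?J * (B - - B)\<^sup>2) = -2 * \<delta>\<^sup>2 * m / (2 * B)\<^sup>2"
    using m B by (simp add: power2_eq_square field_simps)
  finally show ?thesis by simp
qed

subsection \<open>Detection delay and false alarms\<close>

lemma first_passage_cases:
  assumes "{t. 1 \<le> t \<and> ennreal b \<le> Y t} \<noteq> {}"
  obtains t where "first_passage b Y = enat t" "1 \<le> t" "ennreal b \<le> Y t"
proof -
  let ?S = "enat ` {t. 1 \<le> t \<and> ennreal b \<le> Y t}"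
  obtain e where "e \<in> ?S" using assms by auto
  then have "(LEAST x. x \<in> ?S) \<in> ?S" by (rule LeastI)
  then have "first_passage b Y \<in> ?S"
    using assms by (simp only: first_passage_def Inf_enat_def image_is_empty if_False)
  then show ?thesis using that by auto
qed

text \<open>The bound \<open>r\<close> is real because the deadline
  \<open>T + A * ln \<gamma>\<close> need not be an integer. The direction to the right uses that a
  nonempty infimum of times is attained.\<close>

lemma first_passage_le_real_iff:
  "ereal_of_enat (first_passage b Y) \<le> ereal r \<longleftrightarrow> (\<exists>t\<ge>1. real t \<le> r \<and> ennreal b \<le> Y t)"
proof
  assume *: "ereal_of_enat (first_passage b Y) \<le> ereal r"
  have "{t. 1 \<le> t \<and> ennreal b \<le> Y t} \<noteq> {}"
  proof
    assume "{t. 1 \<le> t \<and> ennreal b \<le> Y t} = {}"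
    then have "first_passage b Y = \<infinity>" 
      by (simp only: first_passage_def image_empty Inf_empty top_enat_def)
    then show False using * by simp
  qed
  then obtain t where "first_passage b Y = enat t" "1 \<le> t" "ennreal b \<le> Y t"
    by (rule first_passage_cases)
  then show "\<exists>t\<ge>1. real t \<le> r \<and> ennreal b \<le> Y t"
    using * by auto
next
  assume "\<exists>t\<ge>1. real t \<le> r \<and> ennreal b \<le> Y t"
  then obtain t where t: "1 \<le> t" "real t \<le> r" "ennreal b \<le> Y t" by auto
  then have "first_passage b Y \<le> enat t"
    unfolding first_passage_def by (intro Inf_lower) auto
  then have "ereal_of_enat (first_passage b Y) \<le> ereal_of_enat (enat t)"
    by (simp only: ereal_of_enat_le_iff)
  also have "\<dots> \<le> ereal r" using t by simp
  finally show "ereal_of_enat (first_passage b Y) \<le> ereal r" .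
qed

lemma less_first_passage_iff:
  "enat N < first_passage b Y \<longleftrightarrow> (\<forall>t\<in>{1..N}. \<not> ennreal b \<le> Y t)"
proof -
  have "first_passage b Y \<le> enat N \<longleftrightarrow> ereal_of_enat (first_passage b Y) \<le> ereal (real N)"
    using ereal_of_enat_le_iff[of "first_passage b Y" "enat N"] by simp
  then show ?thesis
    unfolding first_passage_le_real_iff by (auto simp: not_le[symmetric])
qed

lemma le_ext_lnD:
  assumes "ereal r \<le> ext_ln x"
  shows "ennreal (exp r) \<le> x"
proof (cases x)
  case (real y)
  then have "y \<noteq> 0" "r \<le> ln y"
    using assms by (auto simp: ext_ln_def split: if_splits)
  then have "exp r \<le> y"
    using real by (simp add: ln_ge_iff)
  then show ?thesis using real by (simp add: ennreal_leI)
qed simp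

lemma measurable_mixture:
  assumes "sigma_finite_measure \<pi>" and f: "(\<lambda>(\<theta>, z). f \<theta> z) \<in> borel_measurable (\<pi> \<Otimes>\<^sub>M borel)"
    and k: "1 \<le> k" and P: "sets P0 = sets borel" "sets P1 = sets borel"
  shows "(\<lambda>\<omega>. mixture f \<pi> (conf_pval \<omega>) k t) \<in> borel_measurable (row_law P0 T P1)"
proof -
  interpret sigma_finite_measure \<pi> by fact
  let ?M = "row_law P0 T P1"
  have "(\<lambda>z. f (snd z) (conf_pval (fst z) j)) \<in> borel_measurable (?M \<Otimes>\<^sub>M \<pi>)" if "j \<in> {k..t}" for j
  proof -
    have [measurable]: "(\<lambda>\<omega>. conf_pval \<omega> j) \<in> borel_measurable ?M"
      using measurable_conf_pval[of j] that k by (simp add: measurable_cong_sets[OF sets_row_law[OF P]])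
    have "(\<lambda>z. (snd z, conf_pval (fst z) j)) \<in> measurable (?M \<Otimes>\<^sub>M \<pi>) (\<pi> \<Otimes>\<^sub>M borel)"
      by measurable
    from measurable_compose[OF this f] show ?thesis by simp
  qed
  then have "(\<lambda>z. ennreal (\<Prod>j=k..t. f (snd z) (conf_pval (fst z) j))) \<in> borel_measurable (?M \<Otimes>\<^sub>M \<pi>)"
    by (intro measurable_compose[OF borel_measurable_prod measurable_ennreal])
  then show ?thesis
    unfolding mixture_def by (intro borel_measurable_nn_integral) (simp add: case_prod_beta')
qed

text \<open>Rewrites the divergence as the mean of the variables \<open>ln (h (F (X j)))\<close>
  after the change. \<open>h\<close> is a density only up to null sets of \<open>unif\<close>;
  absolute continuity carries the a.e. identity over to \<open>H\<close>.\<close>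

lemma KL_divergence_H_law:
  assumes P0: "real_distribution P0" and P1: "real_distribution P1"
    and ac: "absolutely_continuous unif (H_law P0 P1)"
    and RN: "AE z in unif. RN_deriv unif (H_law P0 P1) z = ennreal (h z)"
    and h_pos: "\<And>z. z \<in> {0..1} \<Longrightarrow> 0 < h z"
    and cont: "continuous_on {0..1} (\<lambda>z. ln (h z))"
  shows "(\<lambda>y. ln (h (cdf P0 y))) \<in> borel_measurable borel"
    and "KL_divergence (exp 1) unif (H_law P0 P1) = (\<integral>y. ln (h (cdf P0 y)) \<partial>P1)"
proof -
  interpret P0: real_distribution P0 by fact
  interpret P1: real_distribution P1 by fact
  have cdf [measurable]: "cdf P0 \<in> borel_measurable borel"
    by (intro borel_measurable_mono) (auto simp: mono_def P0.cdf_nondecreasing)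
  \<comment> \<open>Cutting off outside \<open>[0, 1]\<close> makes \<open>\<phi>\<close> Borel
    although nothing is known about \<open>h\<close> there; \<open>cdf P0\<close> stays in
    \<open>[0, 1]\<close>, so the cut is invisible after composition.\<close>
  define \<phi> where "\<phi> z = indicator {0..1} z *\<^sub>R ln (h z)" for z :: real
  have [measurable]: "\<phi> \<in> borel_measurable borel"
    unfolding \<phi>_def using cont by (intro borel_measurable_continuous_on_indicator) auto
  have \<phi>_cdf: "\<phi> (cdf P0 y) = ln (h (cdf P0 y))" for y
    using P0.cdf_nonneg P0.cdf_bounded_prob by (simp add: \<phi>_def)
  have "(\<lambda>y. \<phi> (cdf P0 y)) \<in> borel_measurable borel" by measurable
  then show "(\<lambda>y. ln (h (cdf P0 y))) \<in> borel_measurable borel" by (simp only: \<phi>_cdf)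
  have sH: "sets (H_law P0 P1) = sets unif" by (simp add: H_law_def)
  have "AE z in unif. entropy_density (exp 1) unif (H_law P0 P1) z = \<phi> z"
    using RN AE_unif
  proof eventually_elim
    case (elim z)
    then show ?case
      using h_pos[of z] by (simp add: entropy_density_def \<phi>_def log_def)
  qed
  then have AEH: "AE z in H_law P0 P1. entropy_density (exp 1) unif (H_law P0 P1) z = \<phi> z"
    by (rule absolutely_continuous_AE[OF sH ac])
  have "KL_divergence (exp 1) unif (H_law P0 P1) = (\<integral>z. \<phi> z \<partial>H_law P0 P1)"
    unfolding KL_divergence_def
  proof (rule integral_cong_AE)
    show "entropy_density (exp 1) unif (H_law P0 P1) \<in> borel_measurable (H_law P0 P1)"
      using measurable_entropy_density[of "exp 1" unif "H_law P0 P1"] by (simp add: measurable_cong_sets[OF sH])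
    show "\<phi> \<in> borel_measurable (H_law P0 P1)"
      by (simp add: H_law_def)
  qed (rule AEH)
  also have "\<dots> = (\<integral>y. \<phi> (cdf P0 y) \<partial>P1)"
    unfolding H_law_def by (intro integral_distr) auto
  finally show "KL_divergence (exp 1) unif (H_law P0 P1) = (\<integral>y. ln (h (cdf P0 y)) \<partial>P1)"
    by (simp only: \<phi>_cdf)
qed

text \<open>The nonasymptotic core: off the bad events, and with randomizers in
  \<open>[0, 1]\<close>, detection is a deterministic consequence. \<open>level\<close> is the
  budget: the drift \<open>m * (?D - \<delta>)\<close>, minus the Lipschitz cost of passing from
  \<open>F (X j)\<close> to the p-value, minus the loss in \<open>local_support\<close>, must still
  reach \<open>ln g\<close>.\<close>

lemma detection_prob:
  fixes f :: "'p \<Rightarrow> real \<Rightarrow> real" and h :: "real \<Rightarrow> real" and a c L B \<delta> \<epsilon> g :: real and T m :: nat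
  assumes P0: "real_distribution P0" and P1: "real_distribution P1"
    and \<pi>: "sigma_finite_measure \<pi>" and f: "(\<lambda>(\<theta>, z). f \<theta> z) \<in> borel_measurable (\<pi> \<Otimes>\<^sub>M borel)"
    and F_cont: "continuous_on UNIV (cdf P0)"
    and \<psi>: "(\<lambda>y. ln (h (cdf P0 y))) \<in> borel_measurable borel"
    and B: "0 < B" "\<And>z. z \<in> {0..1} \<Longrightarrow> \<bar>ln (h z)\<bar> \<le> B"
    and L: "0 \<le> L" "\<And>u v. u \<in> {0..1} \<Longrightarrow> v \<in> {0..1} \<Longrightarrow> \<bar>ln (h u) - ln (h v)\<bar> \<le> L * \<bar>u - v\<bar>"
    and local_support: "\<And>r (z :: nat \<Rightarrow> real). 1 \<le> r \<Longrightarrow> (\<And>i. i \<in> {1..r} \<Longrightarrow> z i \<in> {0..1}) \<Longrightarrow>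
      ext_ln (\<integral>\<^sup>+\<theta>. ennreal (\<Prod>i=1..r. f \<theta> (z i)) \<partial>\<pi>)
        \<ge> ereal ((\<Sum>i=1..r. ln (h (z i))) - a * ln (real r) - c)"
    and T: "1 \<le> T" and m: "1 \<le> m" and \<delta>: "0 \<le> \<delta>" and \<epsilon>: "0 < \<epsilon>" and g: "0 < g"
    and level: "ln g \<le> m * ((\<integral>y. ln (h (cdf P0 y)) \<partial>P1) - \<delta>) - L * m * (\<epsilon> + m / T) - a * ln m - c"
  shows "1 - (2 * exp (-2 * \<delta>\<^sup>2 * m / (2 * B)\<^sup>2) + m * (4 * exp (-2 * \<epsilon>\<^sup>2 * T)))
    \<le> \<P>(\<omega> in row_law P0 T P1. ennreal g \<le> mixture f \<pi> (conf_pval \<omega>) (T + 1) (T + m))"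
proof -
  interpret P0: real_distribution P0 by fact
  interpret P1: real_distribution P1 by fact
  let ?M = "row_law P0 T P1"
  interpret row: prob_space ?M
    by (intro prob_space_row_law P0.prob_space_axioms P1.prob_space_axioms)
  let ?J = "{T + 1..T + m}" and ?F = "cdf P0"
  let ?D = "\<integral>y. ln (h (?F y)) \<partial>P1"
  have F01: "?F y \<in> {0..1}" for y
    using P0.cdf_nonneg P0.cdf_bounded_prob by simp
  have cdf [measurable]: "?F \<in> borel_measurable borel"
    by (intro borel_measurable_mono) (auto simp: mono_def P0.cdf_nondecreasing)
  have comp: "(\<lambda>\<omega>. fst \<omega> j) \<in> borel_measurable ?M" if "1 \<le> j" for j
    using that by (auto simp: measurable_cong_sets[OF sets_row_law refl]
        intro!: measurable_compose[OF measurable_fst] measurable_component_singleton)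
  define Bad0 where "Bad0 = {\<omega>\<in>space ?M. \<delta> * m \<le> \<bar>(\<Sum>j=T+1..T+m. ln (h (?F (fst \<omega> j)))) - m * ?D\<bar>}"
  define BadL where "BadL j = {\<omega>\<in>space ?M. \<epsilon> * T \<le> \<bar>(\<Sum>k=1..T. of_bool (fst \<omega> k < fst \<omega> j)) - T * ?F (fst \<omega> j)\<bar>}" for j
  define BadU where "BadU j = {\<omega>\<in>space ?M. \<epsilon> * T \<le> \<bar>(\<Sum>k=1..T. of_bool (fst \<omega> k \<le> fst \<omega> j)) - T * ?F (fst \<omega> j)\<bar>}" for j
  define Bad where "Bad = Bad0 \<union> (\<Union>j\<in>?J. BadL j \<union> BadU j)"
  have meas0: "Bad0 \<in> sets ?M"
  proof -
    have [measurable]: "(\<lambda>\<omega>. ln (h (?F (fst \<omega> j)))) \<in> borel_measurable ?M" if "j \<in> ?J" for j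
      using that by (intro measurable_compose[OF comp \<psi>]) auto
    show ?thesis unfolding Bad0_def by measurable
  qed
  have measLU: "BadL j \<in> sets ?M" "BadU j \<in> sets ?M" if "j \<in> ?J" for j
  proof -
    have [measurable]: "(\<lambda>\<omega>. fst \<omega> j) \<in> borel_measurable ?M" "\<And>k. k \<in> {1..T} \<Longrightarrow> (\<lambda>\<omega>. fst \<omega> k) \<in> borel_measurable ?M"
      using that by (auto intro!: comp)
    show "BadL j \<in> sets ?M" "BadU j \<in> sets ?M"
      unfolding BadL_def BadU_def by measurable
  qed
  \<comment> \<open>Continuity of the CDF excludes atoms, so the strict count has mean
    \<open>T * ?F y\<close> as well and both counts concentrate at the same value.\<close>
  have lt_cdf: "P0.prob {x. x < y} = ?F y" for y
  proof -
    have "P0.prob {y} = 0"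
      using F_cont P0.isCont_cdf[of y] by (simp add: continuous_on_eq_continuous_at)
    moreover have "P0.prob {..y} = P0.prob {..<y} + P0.prob {y}"
      by (subst P0.finite_measure_Union[symmetric]) (auto intro!: arg_cong[of _ _ P0.prob])
    ultimately show ?thesis
      by (simp add: cdf_def lessThan_def)
  qed
  have bound0: "row.prob Bad0 \<le> 2 * exp (-2 * \<delta>\<^sup>2 * m / (2 * B)\<^sup>2)"
    unfolding Bad0_def using B F01 by (intro prob_post_change_deviation P0 P1 m \<delta> \<psi>) auto
  have boundL: "row.prob (BadL j) \<le> 2 * exp (-2 * \<epsilon>\<^sup>2 * T)" if "j \<in> ?J" for j
    unfolding BadL_def using that
    by (intro prob_rank_deviation[where R = "(<)"] P0 P1 T \<epsilon> lt_cdf) auto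
  have boundU: "row.prob (BadU j) \<le> 2 * exp (-2 * \<epsilon>\<^sup>2 * T)" if "j \<in> ?J" for j
    unfolding BadU_def using that
    by (intro prob_rank_deviation[where R = "(\<le>)"] P0 P1 T \<epsilon>) (auto simp: cdf_def atMost_def)
  have "row.prob Bad \<le> row.prob Bad0 + row.prob (\<Union>j\<in>?J. BadL j \<union> BadU j)"
    unfolding Bad_def using meas0 measLU by (intro measure_Un_le sets.finite_UN) auto
  also have "row.prob (\<Union>j\<in>?J. BadL j \<union> BadU j) \<le> (\<Sum>j\<in>?J. row.prob (BadL j \<union> BadU j))"
    using measLU by (intro row.finite_measure_subadditive_finite) auto
  \<comment> \<open>The 4 stems from two events per window index, each with a two-sided Hoeffding
    bound.\<close>
  also have "\<dots> \<le> (\<Sum>j\<in>?J. 4 * exp (-2 * \<epsilon>\<^sup>2 * T))"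
  proof (intro sum_mono)
    fix j assume j: "j \<in> ?J"
    have "row.prob (BadL j \<union> BadU j) \<le> row.prob (BadL j) + row.prob (BadU j)"
      using measLU[OF j] by (intro measure_Un_le) auto
    then show "row.prob (BadL j \<union> BadU j) \<le> 4 * exp (-2 * \<epsilon>\<^sup>2 * T)"
      using boundL[OF j] boundU[OF j] by simp
  qed
  finally have Bad: "row.prob Bad \<le> 2 * exp (-2 * \<delta>\<^sup>2 * m / (2 * B)\<^sup>2) + m * (4 * exp (-2 * \<epsilon>\<^sup>2 * T))"
    using bound0 by simp
  have Bad_sets: "Bad \<in> sets ?M"
    unfolding Bad_def using meas0 measLU by auto
  let ?G = "{\<omega>\<in>space ?M. ennreal g \<le> mixture f \<pi> (conf_pval \<omega>) (T + 1) (T + m)}"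
  have G_sets: "?G \<in> sets ?M"
  proof -
    have [measurable]: "(\<lambda>\<omega>. mixture f \<pi> (conf_pval \<omega>) (T + 1) (T + m)) \<in> borel_measurable ?M"
      by (intro measurable_mixture \<pi> f) auto
    show ?thesis by measurable
  qed
  have good: "\<omega> \<in> ?G" if \<omega>: "\<omega> \<in> space ?M" "\<omega> \<notin> Bad" and l: "\<forall>j\<in>{1..}. snd \<omega> j \<in> {0..1}" for \<omega>
  proof -
    let ?p = "conf_pval \<omega>"
    have p01: "?p j \<in> {0..1}" if "1 \<le> j" for j
      using l that by (intro conf_pval_in_unit) auto
    have close: "\<bar>?p j - ?F (fst \<omega> j)\<bar> \<le> \<epsilon> + m / T" if j: "j \<in> ?J" for j
    proof -
      have "\<omega> \<notin> BadL j" "\<omega> \<notin> BadU j" using \<omega> j by (auto simp: Bad_def)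
      then have "\<bar>(\<Sum>k=1..T. of_bool (fst \<omega> k < fst \<omega> j)) - T * ?F (fst \<omega> j)\<bar> < \<epsilon> * T"
        "\<bar>(\<Sum>k=1..T. of_bool (fst \<omega> k \<le> fst \<omega> j)) - T * ?F (fst \<omega> j)\<bar> < \<epsilon> * T"
        using \<omega> by (auto simp: BadL_def BadU_def simp del: sum_of_bool_eq)
      from conf_pval_near_reference[OF T j _ this, of "snd \<omega>"] l j show ?thesis by simp
    qed
    have "m * (?D - \<delta>) \<le> (\<Sum>j\<in>?J. ln (h (?F (fst \<omega> j))))"
    proof -
      have "\<omega> \<notin> Bad0" using \<omega> by (auto simp: Bad_def)
      then have "\<bar>(\<Sum>j\<in>?J. ln (h (?F (fst \<omega> j)))) - m * ?D\<bar> < \<delta> * m"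
        using \<omega> by (auto simp: Bad0_def)
      then show ?thesis by (simp add: algebra_simps abs_less_iff)
    qed
    also have "\<dots> \<le> (\<Sum>j\<in>?J. ln (h (?p j)) + L * (\<epsilon> + m / T))"
    proof (intro sum_mono)
      fix j assume j: "j \<in> ?J"
      have "\<bar>ln (h (?p j)) - ln (h (?F (fst \<omega> j)))\<bar> \<le> L * \<bar>?p j - ?F (fst \<omega> j)\<bar>"
        using j by (intro L F01 p01) auto
      also have "\<dots> \<le> L * (\<epsilon> + m / T)"
        using close[OF j] L by (intro mult_left_mono) auto
      finally show "ln (h (?F (fst \<omega> j))) \<le> ln (h (?p j)) + L * (\<epsilon> + m / T)" by linarith
    qed
    also have "\<dots> = (\<Sum>j\<in>?J. ln (h (?p j))) + L * m * (\<epsilon> + m / T)"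
      by (simp add: sum.distrib)
    also have "(\<Sum>j\<in>?J. ln (h (?p j))) = (\<Sum>i=1..m. ln (h (?p (i + T))))"
      using sum.shift_bounds_cl_nat_ivl[of "\<lambda>j. ln (h (?p j))" 1 T m] by (simp add: add.commute)
    finally have "ln g \<le> (\<Sum>i=1..m. ln (h (?p (i + T)))) - a * ln m - c"
      using level by linarith
    moreover have "ereal ((\<Sum>i=1..m. ln (h (?p (i + T)))) - a * ln m - c)
        \<le> ext_ln (\<integral>\<^sup>+\<theta>. ennreal (\<Prod>i=1..m. f \<theta> (?p (i + T))) \<partial>\<pi>)"
      using m by (intro local_support p01) auto
    ultimately have "ereal (ln g) \<le> ext_ln (\<integral>\<^sup>+\<theta>. ennreal (\<Prod>i=1..m. f \<theta> (?p (i + T))) \<partial>\<pi>)"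
      by (meson ereal_less_eq(3) order_trans)
    then have "ennreal g \<le> (\<integral>\<^sup>+\<theta>. ennreal (\<Prod>i=1..m. f \<theta> (?p (i + T))) \<partial>\<pi>)"
      using le_ext_lnD g by fastforce
    also have "\<dots> = mixture f \<pi> ?p (T + 1) (T + m)"
      unfolding mixture_def
      using prod.shift_bounds_cl_nat_ivl[of "\<lambda>j. f \<theta> (?p j)" 1 T m for \<theta>] by (simp add: add.commute)
    finally show ?thesis using \<omega> by simp
  qed
  have "row.prob (space ?M - Bad) \<le> row.prob ?G"
  proof (rule row.finite_measure_mono_AE[OF _ G_sets])
    show "AE \<omega> in ?M. \<omega> \<in> space ?M - Bad \<longrightarrow> \<omega> \<in> ?G"
      using AE_row_law_snd[OF P0.prob_space_axioms P1.prob_space_axioms, of T]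
    proof eventually_elim
      case (elim \<omega>)
      then show ?case using good[of \<omega>] by blast
    qed
  qed
  then show ?thesis
    using Bad Bad_sets by (simp add: row.prob_compl)
qed

text \<open>Where all randomizers lie in \<open>[0, 1]\<close>, so do the p-values, the densities
  are nonnegative at them, and \<open>S_stat\<close> with unit weights equals
  \<open>mix_sum\<close>; elsewhere the real product inside \<open>mixture\<close> may contain
  negative factors. Hence the two crossing events are compared almost surely.\<close>

lemma no_false_alarm_prob:
  fixes g :: real
  assumes P0: "real_distribution P0" and P1: "real_distribution P1"
    and \<pi>: "prob_space \<pi>" and dens: "density_family \<pi> f" and w: "\<And>k. 1 \<le> k \<Longrightarrow> w k = 1" and g: "0 < g"
  shows "1 - T / g \<le> \<P>(\<omega> in row_law P0 T P1. \<forall>t\<in>{1..T}. \<not> ennreal g \<le> S_stat f \<pi> w (conf_pval \<omega>) t)"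
proof -
  interpret P0: real_distribution P0 by fact
  interpret P1: real_distribution P1 by fact
  let ?M = "row_law P0 T P1"
  interpret row: prob_space ?M
    by (intro prob_space_row_law P0.prob_space_axioms P1.prob_space_axioms)
  interpret \<pi>: prob_space \<pi> by fact
  have f: "(\<lambda>(\<theta>, z). f \<theta> z) \<in> borel_measurable (\<pi> \<Otimes>\<^sub>M borel)"
    and f_nn: "\<And>\<theta> z. \<theta> \<in> space \<pi> \<Longrightarrow> z \<in> {0..1} \<Longrightarrow> 0 \<le> f \<theta> z"
    and f_int: "\<And>\<theta>. \<theta> \<in> space \<pi> \<Longrightarrow> (\<integral>\<^sup>+z\<in>{0..1}. ennreal (f \<theta> z) \<partial>lborel) = 1"
    using dens by (auto simp: density_family_def)
  let ?F = "\<lambda>\<theta> z. ennreal (f \<theta> z)"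
  interpret density_mixture \<pi> ?F
  proof unfold_locales
    show F: "(\<lambda>(\<theta>, z). ?F \<theta> z) \<in> borel_measurable (\<pi> \<Otimes>\<^sub>M borel)"
      using measurable_compose[OF f measurable_ennreal] by (simp add: case_prod_beta')
    fix \<theta> assume \<theta>: "\<theta> \<in> space \<pi>"
    have "?F \<theta> \<in> borel_measurable borel"
      using measurable_compose[OF measurable_Pair1'[OF \<theta>] F] by simp
    then show "(\<integral>\<^sup>+z. ?F \<theta> z \<partial>unif) = 1"
      using f_int[OF \<theta>] by (simp add: nn_integral_unif)
  qed
  let ?A = "{\<omega>\<in>space ?M. \<exists>t\<in>{1..T}. ennreal g \<le> S_stat f \<pi> w (conf_pval \<omega>) t}"
  let ?B = "{\<omega>\<in>space ?M. \<exists>t\<in>{1..T}. ennreal g \<le> mix_sum (conf_pval \<omega>) t}"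
  have B_sets: "?B \<in> sets ?M"
  proof -
    have [measurable]: "(\<lambda>\<omega>. mix_sum (conf_pval \<omega>) t) \<in> borel_measurable ?M" for t
      unfolding mix_sum_def mix_def
      by (intro borel_measurable_sum measurable_mixture_nn_integral F \<pi>.sigma_finite_measure_axioms)
        (use measurable_conf_pval in \<open>auto simp: measurable_cong_sets[OF sets_row_law]\<close>)
    show ?thesis by measurable
  qed
  have A_sets: "?A \<in> sets ?M"
  proof -
    have [measurable]: "(\<lambda>\<omega>. S_stat f \<pi> w (conf_pval \<omega>) t) \<in> borel_measurable ?M" for t
      unfolding S_stat_def
      by (intro borel_measurable_sum borel_measurable_times_ennreal measurable_mixture
          \<pi>.sigma_finite_measure_axioms f) auto
    show ?thesis by measurable
  qed
  have eq: "S_stat f \<pi> w (conf_pval \<omega>) t = mix_sum (conf_pval \<omega>) t" if l: "\<forall>j\<in>{1..}. snd \<omega> j \<in> {0..1}" for \<omega> t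
  proof -
    have p: "conf_pval \<omega> j \<in> {0..1}" if "1 \<le> j" for j
      using l that by (intro conf_pval_in_unit) auto
    have "mixture f \<pi> (conf_pval \<omega>) k t = mix (conf_pval \<omega>) k t" if "1 \<le> k" for k
      unfolding mixture_def mix_def using f_nn p that by (intro nn_integral_cong prod_ennreal[symmetric]) auto
    then show ?thesis
      unfolding S_stat_def mix_sum_def using w by (intro sum.cong) auto
  qed
  have "row.prob ?A \<le> row.prob ?B"
  proof (rule row.finite_measure_mono_AE[OF _ B_sets])
    show "AE \<omega> in ?M. \<omega> \<in> ?A \<longrightarrow> \<omega> \<in> ?B"
      using AE_row_law_snd[OF P0.prob_space_axioms P1.prob_space_axioms, of T]
      by eventually_elim (simp add: eq)
  qed
  also have "row.prob ?B \<le> T / g"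
  proof -
    have "ennreal (g * row.prob ?B) \<le> ennreal T"
      using false_alarm_bound[OF P0 P1, of "ennreal g" T] g
      by (simp add: row.emeasure_eq_measure ennreal_mult' ennreal_of_nat_eq_real_of_nat)
    then show ?thesis
      using g by (simp add: field_simps)
  qed
  finally have "1 - T / g \<le> row.prob (space ?M - ?A)"
    using A_sets by (simp only: row.prob_compl)
  also have "space ?M - ?A = {\<omega>\<in>space ?M. \<forall>t\<in>{1..T}. \<not> ennreal g \<le> S_stat f \<pi> w (conf_pval \<omega>) t}"
    by auto
  finally show ?thesis .
qed

section \<open>Comparison of the statistics and passage to the limit\<close>

lemma le_Z_stat_iff:
  "1 \<le> t \<Longrightarrow> x \<le> Z_stat f \<pi> w p t \<longleftrightarrow> (\<exists>k\<in>{1..t}. x \<le> ennreal (w k) * mixture f \<pi> p k t)"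
  unfolding Z_stat_def by (subst Max_ge_iff) auto

lemma Z_stat_le_S_stat: "1 \<le> t \<Longrightarrow> Z_stat f \<pi> w p t \<le> S_stat f \<pi> w p t"
  unfolding Z_stat_def S_stat_def by (subst Max_le_iff) (auto intro: member_le_sum)

lemma detection_delay_limit:
  fixes f :: "'p \<Rightarrow> real \<Rightarrow> real" and h :: "real \<Rightarrow> real" and a c A L B :: real
    and T :: "nat \<Rightarrow> nat" and \<gamma> :: "nat \<Rightarrow> real"
  assumes P0: "real_distribution P0" and P1: "real_distribution P1"
    and \<pi>: "sigma_finite_measure \<pi>" and f: "(\<lambda>(\<theta>, z). f \<theta> z) \<in> borel_measurable (\<pi> \<Otimes>\<^sub>M borel)"
    and F_cont: "continuous_on UNIV (cdf P0)"
    and \<psi>: "(\<lambda>y. ln (h (cdf P0 y))) \<in> borel_measurable borel"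
    and B: "0 < B" "\<And>z. z \<in> {0..1} \<Longrightarrow> \<bar>ln (h z)\<bar> \<le> B"
    and L: "0 \<le> L" "\<And>u v. u \<in> {0..1} \<Longrightarrow> v \<in> {0..1} \<Longrightarrow> \<bar>ln (h u) - ln (h v)\<bar> \<le> L * \<bar>u - v\<bar>"
    and local_support: "\<And>r (z :: nat \<Rightarrow> real). 1 \<le> r \<Longrightarrow> (\<And>i. i \<in> {1..r} \<Longrightarrow> z i \<in> {0..1}) \<Longrightarrow>
      ext_ln (\<integral>\<^sup>+\<theta>. ennreal (\<Prod>i=1..r. f \<theta> (z i)) \<partial>\<pi>)
        \<ge> ereal ((\<Sum>i=1..r. ln (h (z i))) - a * ln (real r) - c)"
    and a: "0 \<le> a"
    and D: "0 < (\<integral>y. ln (h (cdf P0 y)) \<partial>P1)" and A: "1 / (\<integral>y. ln (h (cdf P0 y)) \<partial>P1) < A"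
    and T_lim: "filterlim T at_top sequentially" and \<gamma>_lim: "filterlim \<gamma> at_top sequentially"
    and \<gamma>_T: "(\<lambda>n. ln (\<gamma> n)) \<in> o[sequentially](\<lambda>n. real (T n))"
  defines "m \<equiv> \<lambda>n. nat \<lfloor>A * ln (\<gamma> n)\<rfloor>"
  shows "(\<lambda>n. \<P>(\<omega> in row_law P0 (T n) P1. ennreal (\<gamma> n) \<le> mixture f \<pi> (conf_pval \<omega>) (T n + 1) (T n + m n)))
    \<longlonglongrightarrow> 1"
proof -
  define D where "D = (\<integral>y. ln (h (cdf P0 y)) \<partial>P1)"
  note D = D[folded D_def] and A = A[folded D_def]
  have A_pos: "0 < A" using D A by (meson divide_pos_pos less_trans zero_less_one)
  have AD: "1 < A * D" using A D by (simp add: field_simps)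
  \<comment> \<open>\<open>d\<close> is the midpoint of \<open>D\<close> and \<open>1 / A\<close>,
    hence \<open>A * d > 1\<close>. Of the gap \<open>D - d = 2 * \<delta>\<close>, one
    \<open>\<delta>\<close> covers the deviation of the log-likelihood and the other the Lipschitz
    error, which is at most \<open>L * (2 * \<epsilon>)\<close> per observation once
    \<open>m / T \<le> \<epsilon>\<close>. \<open>L + 1\<close> avoids a division by zero for
    \<open>L = 0\<close>.\<close>
  define \<delta> where "\<delta> = (D - 1 / A) / 4"
  define \<epsilon> where "\<epsilon> = \<delta> / (2 * (L + 1))"
  define d where "d = D - 2 * \<delta>"
  have \<delta>: "0 < \<delta>" using AD A_pos by (simp add: \<delta>_def field_simps)
  have \<epsilon>: "0 < \<epsilon>" using \<delta> L(1) by (simp add: \<epsilon>_def)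
  have L\<epsilon>: "L * (2 * \<epsilon>) \<le> \<delta>"
    using \<delta> L(1) by (simp add: \<epsilon>_def field_simps)
  have d: "1 < A * d" and d_pos: "0 < d"
  proof -
    have "d = (D + 1 / A) / 2" by (simp add: d_def \<delta>_def field_simps)
    then have "A * d = (A * D + 1) / 2" using A_pos by (simp add: field_simps)
    then show "1 < A * d" using AD by simp
    then show "0 < d" using A_pos by (meson less_trans zero_less_mult_pos zero_less_one)
  qed
  have s_lim: "filterlim (\<lambda>n. ln (\<gamma> n)) at_top sequentially"
    by (rule filterlim_compose[OF ln_at_top \<gamma>_lim])
  have rT_lim: "filterlim (\<lambda>n. real (T n)) at_top sequentially"
    by (rule filterlim_compose[OF filterlim_real_sequentially T_lim])
  have As_lim: "filterlim (\<lambda>n. A * ln (\<gamma> n)) at_top sequentially"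
    by (rule filterlim_tendsto_pos_mult_at_top[OF tendsto_const A_pos s_lim])
  \<comment> \<open>Rounding down loses at most one observation, which enters the level as the
    constant \<open>d\<close>.\<close>
  have m_bounds: "A * ln (\<gamma> n) - 1 \<le> m n" "real (m n) \<le> A * ln (\<gamma> n)" if "0 \<le> A * ln (\<gamma> n)" for n
    using that unfolding m_def by linarith+
  have m_lim: "filterlim (\<lambda>n. real (m n)) at_top sequentially"
  proof (rule filterlim_at_top_mono)
    show "filterlim (\<lambda>n. A * ln (\<gamma> n) - 1) at_top sequentially"
      using filterlim_tendsto_add_at_top[OF tendsto_const[of "-1"] As_lim] by (simp add: algebra_simps)
    show "\<forall>\<^sub>F n in sequentially. A * ln (\<gamma> n) - 1 \<le> real (m n)"
      unfolding m_def by (intro always_eventually allI) linarith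
  qed
  have ev_pos: "\<forall>\<^sub>F n in sequentially. 0 \<le> A * ln (\<gamma> n)"
    using As_lim by (simp add: filterlim_at_top)
  have ev_m: "\<forall>\<^sub>F n in sequentially. 1 \<le> m n"
    using m_lim[unfolded filterlim_at_top, rule_format, of 1] by simp
  have ev_T: "\<forall>\<^sub>F n in sequentially. 1 \<le> T n"
    using T_lim by (simp add: filterlim_at_top)
  have ev_g: "\<forall>\<^sub>F n in sequentially. 0 < \<gamma> n"
    using \<gamma>_lim by (simp add: filterlim_at_top_dense)
  have ratio: "(\<lambda>n. A * ln (\<gamma> n) / real (T n)) \<longlonglongrightarrow> 0"
    using tendsto_mult_right_zero[OF smalloD_tendsto[OF \<gamma>_T], of A] by simp
  have ev_ratio: "\<forall>\<^sub>F n in sequentially. A * ln (\<gamma> n) / real (T n) < min \<epsilon> 1"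
    using order_tendstoD(2)[OF ratio, of "min \<epsilon> 1"] \<epsilon> by simp
  have ev_mT: "\<forall>\<^sub>F n in sequentially. real (m n) / T n \<le> \<epsilon> \<and> real (m n) \<le> T n"
    using ev_ratio ev_T ev_pos
  proof eventually_elim
    case (elim n)
    have "real (m n) / T n \<le> A * ln (\<gamma> n) / T n"
      using elim m_bounds[of n] by (intro divide_right_mono) auto
    then have "real (m n) / T n < min \<epsilon> 1" using elim by linarith
    then show ?case using elim by (simp add: field_simps)
  qed
  have ev_level: "\<forall>\<^sub>F n in sequentially. ln (\<gamma> n) \<le> (A * ln (\<gamma> n) - 1) * d - a * ln (A * ln (\<gamma> n)) - c"
  proof -
    \<comment> \<open>\<open>\<kappa>\<close> is the net drift per unit of
      \<open>ln \<gamma>\<close>; being positive, it outweighs the rounding cost \<open>d\<close>,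
      the logarithmic loss and \<open>c\<close>.\<close>
    define \<kappa> where "\<kappa> = A * d - 1"
    have "0 < \<kappa>" using d by (simp add: \<kappa>_def)
    then have "filterlim (\<lambda>s. \<kappa> * s - d - a * ln (A * s) - c) at_top at_top"
      using A_pos by real_asymp
    note filterlim_compose[OF this s_lim, unfolded filterlim_at_top, rule_format, of 0]
    then show ?thesis
      by eventually_elim (simp add: \<kappa>_def algebra_simps)
  qed
  \<comment> \<open>The union bound runs over \<open>m n\<close> indices; since
    \<open>m n \<le> T n\<close> eventually, the factor may be replaced by \<open>T n\<close>, and
    each error term then depends on a single diverging quantity.\<close>
  let ?err = "\<lambda>n. 2 * exp (-2 * \<delta>\<^sup>2 * m n / (2 * B)\<^sup>2) + T n * (4 * exp (-2 * \<epsilon>\<^sup>2 * T n))"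
  have err: "?err \<longlonglongrightarrow> 0"
  proof -
    have lim: "((\<lambda>x :: real. 2 * exp (-2 * \<eta> * x)) \<longlongrightarrow> 0) at_top"
      "((\<lambda>x :: real. x * (4 * exp (-2 * \<eta> * x))) \<longlongrightarrow> 0) at_top" if "0 < \<eta>" for \<eta> :: real
      using that by real_asymp+
    have "0 < \<delta>\<^sup>2 / (2 * B)\<^sup>2" "0 < \<epsilon>\<^sup>2" using \<delta> B(1) \<epsilon> by simp_all
    from tendsto_add[OF filterlim_compose[OF lim(1)[OF this(1)] m_lim] filterlim_compose[OF lim(2)[OF this(2)] rT_lim]]
    show ?thesis by (simp add: mult_ac)
  qed
  let ?P = "\<lambda>n. \<P>(\<omega> in row_law P0 (T n) P1. ennreal (\<gamma> n) \<le> mixture f \<pi> (conf_pval \<omega>) (T n + 1) (T n + m n))"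
  have lower: "\<forall>\<^sub>F n in sequentially. 1 - ?err n \<le> ?P n"
    using ev_level ev_mT ev_pos ev_m ev_T ev_g
  proof eventually_elim
    case (elim n)
    note mb = m_bounds[OF elim(3)]
    have mp: "0 < real (m n)" using elim by simp
    have "(A * ln (\<gamma> n) - 1) * d \<le> m n * d"
      using mb d_pos by (intro mult_right_mono) auto
    moreover have "a * ln (m n) \<le> a * ln (A * ln (\<gamma> n))"
      using mb mp a by (intro mult_left_mono ln_mono) auto
    moreover have "L * m n * (\<epsilon> + m n / T n) \<le> m n * \<delta>"
    proof -
      have "L * (\<epsilon> + m n / T n) \<le> L * (2 * \<epsilon>)"
        using elim L by (intro mult_left_mono) auto
      then have "m n * (L * (\<epsilon> + m n / T n)) \<le> m n * \<delta>"
        using L\<epsilon> by (intro mult_left_mono) auto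
      then show ?thesis by (simp add: mult_ac)
    qed
    moreover have "m n * d = m n * (D - \<delta>) - m n * \<delta>"
      by (simp add: d_def algebra_simps)
    ultimately have level: "ln (\<gamma> n) \<le> m n * (D - \<delta>) - L * m n * (\<epsilon> + m n / T n) - a * ln (m n) - c"
      using elim by linarith
    have "1 - (2 * exp (-2 * \<delta>\<^sup>2 * m n / (2 * B)\<^sup>2) + m n * (4 * exp (-2 * \<epsilon>\<^sup>2 * T n))) \<le> ?P n"
      using elim \<delta> \<epsilon> level
      by (intro detection_prob[OF P0 P1 \<pi> f F_cont \<psi> B L local_support, where \<delta> = \<delta>]) (auto simp: D_def)
    moreover have "m n * (4 * exp (-2 * \<epsilon>\<^sup>2 * T n)) \<le> T n * (4 * exp (-2 * \<epsilon>\<^sup>2 * T n))"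
      using elim by (intro mult_right_mono) auto
    ultimately show ?case by linarith
  qed
  show ?thesis
  proof (rule tendsto_sandwich[OF lower])
    show "(\<lambda>n. 1 - ?err n) \<longlonglongrightarrow> 1"
      using tendsto_diff[OF tendsto_const[of 1] err] by simp
    show "\<forall>\<^sub>F n in sequentially. ?P n \<le> 1"
      using P0 P1 by (intro always_eventually allI prob_space.prob_le_1 prob_space_row_law)
        (auto simp: real_distribution_def)
  qed simp
qed

text \<open>\<open>X\<close> is detection in time and \<open>V\<close> the absence of a false alarm.
  \<open>V\<close> without \<open>X\<close> has probability at most \<open>1 - P(X)\<close>, which
  tends to 0; subtracting it from \<open>P(V)\<close>, and dividing it by \<open>P(V)\<close>, gives
  the two limits. As \<open>P(V)\<close> tends to 1, the default of the conditional probability at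
  \<open>P(V) = 0\<close> cannot affect them.\<close>

lemma tendsto_joint_and_conditional:
  fixes M :: "nat \<Rightarrow> 'a measure" and X V :: "nat \<Rightarrow> 'a \<Rightarrow> bool" and r :: "nat \<Rightarrow> real"
  assumes M: "\<And>n. prob_space (M n)"
    and X: "\<And>n. {\<omega>\<in>space (M n). X n \<omega>} \<in> sets (M n)" and V: "\<And>n. {\<omega>\<in>space (M n). V n \<omega>} \<in> sets (M n)"
    and X_lim: "(\<lambda>n. \<P>(\<omega> in M n. X n \<omega>)) \<longlonglongrightarrow> 1"
    and V_lower: "\<And>n. 1 \<le> n \<Longrightarrow> r n \<le> \<P>(\<omega> in M n. V n \<omega>)" and r: "r \<longlonglongrightarrow> 1"
  shows "(\<lambda>n. \<P>(\<omega> in M n. V n \<omega> \<and> X n \<omega>)) \<longlonglongrightarrow> 1"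
    and "(\<lambda>n. \<P>(\<omega> in M n. \<not> X n \<omega> \<bar> V n \<omega>)) \<longlonglongrightarrow> 0"
proof -
  have le1: "\<P>(\<omega> in M n. Q \<omega>) \<le> 1" for n Q
    by (rule prob_space.prob_le_1[OF M])
  have V_lim: "(\<lambda>n. \<P>(\<omega> in M n. V n \<omega>)) \<longlonglongrightarrow> 1"
    by (rule tendsto_sandwich[OF _ _ r tendsto_const])
      (use V_lower le1 in \<open>auto intro!: eventually_sequentiallyI[of 1]\<close>)
  have miss: "\<P>(\<omega> in M n. \<not> X n \<omega> \<and> V n \<omega>) \<le> 1 - \<P>(\<omega> in M n. X n \<omega>)" for n
  proof -
    interpret prob_space "M n" by (rule M)
    have "prob {\<omega>\<in>space (M n). \<not> X n \<omega> \<and> V n \<omega>} \<le> prob (space (M n) - {\<omega>\<in>space (M n). X n \<omega>})"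
      using X by (intro finite_measure_mono) auto
    then show ?thesis using X by (simp only: prob_compl)
  qed
  have miss_lim: "(\<lambda>n. \<P>(\<omega> in M n. \<not> X n \<omega> \<and> V n \<omega>)) \<longlonglongrightarrow> 0"
  proof (rule tendsto_sandwich[OF _ _ tendsto_const])
    show "(\<lambda>n. 1 - \<P>(\<omega> in M n. X n \<omega>)) \<longlonglongrightarrow> 0"
      using tendsto_diff[OF tendsto_const[of 1] X_lim] by simp
  qed (use miss in auto)
  have "\<P>(\<omega> in M n. V n \<omega> \<and> X n \<omega>) = \<P>(\<omega> in M n. V n \<omega>) - \<P>(\<omega> in M n. \<not> X n \<omega> \<and> V n \<omega>)" for n
  proof -
    interpret prob_space "M n" by (rule M)
    note [measurable] = X[of n] V[of n]
    have "prob {\<omega>\<in>space (M n). V n \<omega>}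
      = prob ({\<omega>\<in>space (M n). V n \<omega> \<and> X n \<omega>} \<union> {\<omega>\<in>space (M n). \<not> X n \<omega> \<and> V n \<omega>})"
      by (intro arg_cong[of _ _ prob]) auto
    also have "\<dots> = prob {\<omega>\<in>space (M n). V n \<omega> \<and> X n \<omega>} + prob {\<omega>\<in>space (M n). \<not> X n \<omega> \<and> V n \<omega>}"
      using X[of n] V[of n] by (intro finite_measure_Union sets.sets_Collect_conj sets.sets_Collect_neg) auto
    finally show ?thesis by simp
  qed
  then show "(\<lambda>n. \<P>(\<omega> in M n. V n \<omega> \<and> X n \<omega>)) \<longlonglongrightarrow> 1"
    using tendsto_diff[OF V_lim miss_lim] by simp
  show "(\<lambda>n. \<P>(\<omega> in M n. \<not> X n \<omega> \<bar> V n \<omega>)) \<longlonglongrightarrow> 0"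
    using tendsto_divide[OF miss_lim V_lim] by (simp add: cond_prob_def)
qed

theorem corollary3p8:
  fixes T :: "nat \<Rightarrow> nat"
    and P0 P1 :: "real measure"
    and f :: "'p \<Rightarrow> real \<Rightarrow> real" and \<pi> :: "'p measure"
    and w \<gamma> :: "nat \<Rightarrow> real"
    and h :: "real \<Rightarrow> real"
    and a c A :: real
  assumes T_pos: "\<And>n. 1 \<le> n \<Longrightarrow> 0 < T n"
    and T_mono: "mono_on {1..} T"
    and T_lim: "filterlim T at_top sequentially"
    and P0: "real_distribution P0" and P1: "real_distribution P1"
    and prior: "prob_space \<pi>" and dens: "density_family \<pi> f"
    and F_cont: "continuous_on UNIV (cdf P0)"
    and H_cont: "continuous_on {0..1} (H_cdf P0 P1)"
    and H_0: "H_cdf P0 P1 0 = 0"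
    and separation: "(SUP t\<in>{0..1}. \<bar>H_cdf P0 P1 t - t\<bar>) > 0"
    and H_ac: "absolutely_continuous unif (H_law P0 P1)"
    and h_RN: "AE z in unif. RN_deriv unif (H_law P0 P1) z = ennreal (h z)"
    and KL_finite: "integrable (H_law P0 P1) (entropy_density (exp 1) unif (H_law P0 P1))"
    and KL_pos: "KL_divergence (exp 1) unif (H_law P0 P1) > 0"
    and h_pos: "\<And>z. z \<in> {0..1} \<Longrightarrow> 0 < h z"
    and phi_bounded: "bounded ((\<lambda>z. ln (h z)) ` {0..1})"
    and phi_lipschitz: "\<exists>L. L-lipschitz_on {0..1} (\<lambda>z. ln (h z))"
    and a_nonneg: "0 \<le> a" and c_nonneg: "0 \<le> c"
    and local_support: "\<And>r (z :: nat \<Rightarrow> real). 1 \<le> r \<Longrightarrow> (\<And>i. i \<in> {1..r} \<Longrightarrow> z i \<in> {0..1}) \<Longrightarrow>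
      ext_ln (\<integral>\<^sup>+\<theta>. ennreal (\<Prod>i=1..r. f \<theta> (z i)) \<partial>\<pi>)
        \<ge> ereal ((\<Sum>i=1..r. ln (h (z i))) - a * ln (real r) - c)"
    and w: "\<And>k. 1 \<le> k \<Longrightarrow> w k = 1"
    and \<gamma>_pos: "\<And>n. 1 \<le> n \<Longrightarrow> 0 < \<gamma> n"
    and \<gamma>_lim: "filterlim \<gamma> at_top sequentially"
    and \<gamma>_T: "(\<lambda>n. ln (\<gamma> n)) \<in> o[sequentially](\<lambda>n. real (T n))"
    and A: "A > 1 / KL_divergence (exp 1) unif (H_law P0 P1)"
  shows "\<forall>\<tau> \<in> {tau_Z f \<pi> w, tau_S f \<pi> w}.
    ((\<lambda>n. \<P>(\<omega> in row_law P0 (T n) P1.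
        ereal_of_enat (\<tau> (\<gamma> n) \<omega>) \<le> ereal (T n + A * ln (\<gamma> n)))) \<longlonglongrightarrow> 1) \<and>
    ((\<lambda>n. real (T n)) \<in> o[sequentially](\<gamma>) \<longrightarrow>
      (\<forall>n\<ge>1. \<P>(\<omega> in row_law P0 (T n) P1. enat (T n) < \<tau> (\<gamma> n) \<omega>) \<ge> 1 - T n / \<gamma> n) \<and>
      ((\<lambda>n. 1 - T n / \<gamma> n) \<longlonglongrightarrow> 1) \<and>
      ((\<lambda>n. \<P>(\<omega> in row_law P0 (T n) P1. enat (T n) < \<tau> (\<gamma> n) \<omega> \<and>
        ereal_of_enat (\<tau> (\<gamma> n) \<omega>) \<le> ereal (T n + A * ln (\<gamma> n)))) \<longlonglongrightarrow> 1) \<and>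
      ((\<lambda>n. \<P>(\<omega> in row_law P0 (T n) P1.
        ereal (T n + A * ln (\<gamma> n)) < ereal_of_enat (\<tau> (\<gamma> n) \<omega>)
          \<bar> enat (T n) < \<tau> (\<gamma> n) \<omega>)) \<longlonglongrightarrow> 0))"
proof -
  interpret P0: real_distribution P0 by fact
  interpret P1: real_distribution P1 by fact
  interpret \<pi>: prob_space \<pi> by fact
  have f: "(\<lambda>(\<theta>, z). f \<theta> z) \<in> borel_measurable (\<pi> \<Otimes>\<^sub>M borel)"
    using dens by (simp add: density_family_def)
  obtain L where lip: "L-lipschitz_on {0..1} (\<lambda>z. ln (h z))"
    using phi_lipschitz by blast
  obtain B where B: "0 < B" "\<And>z. z \<in> {0..1} \<Longrightarrow> \<bar>ln (h z)\<bar> \<le> B"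
    using phi_bounded by (auto simp: bounded_pos)
  note KL = KL_divergence_H_law[OF P0 P1 H_ac h_RN h_pos lipschitz_on_continuous_on[OF lip]]
  let ?m = "\<lambda>n. nat \<lfloor>A * ln (\<gamma> n)\<rfloor>"
  let ?M = "\<lambda>n. row_law P0 (T n) P1"
  have prow: "prob_space (?M n)" for n
    by (intro prob_space_row_law P0.prob_space_axioms P1.prob_space_axioms)
  have detect: "(\<lambda>n. \<P>(\<omega> in ?M n. ennreal (\<gamma> n) \<le> mixture f \<pi> (conf_pval \<omega>) (T n + 1) (T n + ?m n)))
    \<longlonglongrightarrow> 1"
  proof (rule detection_delay_limit[OF P0 P1 \<pi>.sigma_finite_measure_axioms f F_cont KL(1) B
        lipschitz_on_nonneg[OF lip] _ local_support a_nonneg _ _ T_lim \<gamma>_lim \<gamma>_T])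
    show "\<bar>ln (h u) - ln (h v)\<bar> \<le> L * \<bar>u - v\<bar>" if "u \<in> {0..1}" "v \<in> {0..1}" for u v
      using lipschitz_onD[OF lip that] by (simp add: dist_real_def)
  qed (use KL_pos A KL(2) in simp_all)
  \<comment> \<open>One argument for both statistics: \<open>Y\<close> lies above every single
    mixture, so the window mixture triggers detection, and below \<open>S_stat\<close>, so the false
    alarm bound for \<open>S_stat\<close> carries over.\<close>
  have main: "((\<lambda>n. \<P>(\<omega> in ?M n. ereal_of_enat (\<tau> (\<gamma> n) \<omega>) \<le> ereal (T n + A * ln (\<gamma> n)))) \<longlonglongrightarrow> 1) \<and>
    ((\<lambda>n. real (T n)) \<in> o[sequentially](\<gamma>) \<longrightarrow>
      (\<forall>n\<ge>1. \<P>(\<omega> in ?M n. enat (T n) < \<tau> (\<gamma> n) \<omega>) \<ge> 1 - T n / \<gamma> n) \<and>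
      ((\<lambda>n. 1 - T n / \<gamma> n) \<longlonglongrightarrow> 1) \<and>
      ((\<lambda>n. \<P>(\<omega> in ?M n. enat (T n) < \<tau> (\<gamma> n) \<omega> \<and>
        ereal_of_enat (\<tau> (\<gamma> n) \<omega>) \<le> ereal (T n + A * ln (\<gamma> n)))) \<longlonglongrightarrow> 1) \<and>
      ((\<lambda>n. \<P>(\<omega> in ?M n. ereal (T n + A * ln (\<gamma> n)) < ereal_of_enat (\<tau> (\<gamma> n) \<omega>)
          \<bar> enat (T n) < \<tau> (\<gamma> n) \<omega>)) \<longlonglongrightarrow> 0))"
    if \<tau>: "\<And>b \<omega>. \<tau> b \<omega> = first_passage b (Y (conf_pval \<omega>))"
      and Y_meas: "\<And>n t b. 1 \<le> t \<Longrightarrow> {\<omega>\<in>space (?M n). ennreal b \<le> Y (conf_pval \<omega>) t} \<in> sets (?M n)"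
      and Y_ge: "\<And>p k t. 1 \<le> k \<Longrightarrow> k \<le> t \<Longrightarrow> mixture f \<pi> p k t \<le> Y p t"
      and Y_le: "\<And>p t. 1 \<le> t \<Longrightarrow> Y p t \<le> S_stat f \<pi> w p t"
    for \<tau> :: "real \<Rightarrow> (nat \<Rightarrow> real) \<times> (nat \<Rightarrow> real) \<Rightarrow> enat" and Y :: "(nat \<Rightarrow> real) \<Rightarrow> nat \<Rightarrow> ennreal"
  proof -
    let ?X = "\<lambda>n \<omega>. ereal_of_enat (\<tau> (\<gamma> n) \<omega>) \<le> ereal (T n + A * ln (\<gamma> n))"
    let ?V = "\<lambda>n \<omega>. enat (T n) < \<tau> (\<gamma> n) \<omega>"
    have X_iff: "?X n \<omega> \<longleftrightarrow> (\<exists>t\<in>{1..}. real t \<le> T n + A * ln (\<gamma> n) \<and> ennreal (\<gamma> n) \<le> Y (conf_pval \<omega>) t)" for n \<omega>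
      unfolding \<tau> first_passage_le_real_iff by auto
    have V_iff: "?V n \<omega> \<longleftrightarrow> (\<forall>t\<in>{1..T n}. \<not> ennreal (\<gamma> n) \<le> Y (conf_pval \<omega>) t)" for n \<omega>
      unfolding \<tau> less_first_passage_iff ..
    have X_sets: "{\<omega>\<in>space (?M n). ?X n \<omega>} \<in> sets (?M n)" for n
    proof -
      \<comment> \<open>As a countable union over times, the event needs only the measurability of
        \<open>Y\<close> at each time.\<close>
      have "{\<omega>\<in>space (?M n). ?X n \<omega>} = (\<Union>t\<in>{t. 1 \<le> t \<and> real t \<le> T n + A * ln (\<gamma> n)}.
          {\<omega>\<in>space (?M n). ennreal (\<gamma> n) \<le> Y (conf_pval \<omega>) t})"
        unfolding X_iff by auto
      also have "\<dots> \<in> sets (?M n)"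
        by (intro sets.countable_UN') (auto intro: Y_meas)
      finally show ?thesis .
    qed
    have V_sets: "{\<omega>\<in>space (?M n). ?V n \<omega>} \<in> sets (?M n)" for n
      unfolding V_iff
      by (intro sets.sets_Collect_finite_All sets.sets_Collect_neg Y_meas) auto
    have X_lim: "(\<lambda>n. \<P>(\<omega> in ?M n. ?X n \<omega>)) \<longlonglongrightarrow> 1"
    proof (rule tendsto_sandwich[OF _ _ detect tendsto_const])
      have "0 < A"
        using A KL_pos by (meson divide_pos_pos less_trans zero_less_one)
      then have "filterlim (\<lambda>n. A * ln (\<gamma> n)) at_top sequentially"
        by (rule filterlim_tendsto_pos_mult_at_top[OF tendsto_const _ filterlim_compose[OF ln_at_top \<gamma>_lim]])
      then have "\<forall>\<^sub>F n in sequentially. 1 \<le> A * ln (\<gamma> n)"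
        by (simp add: filterlim_at_top)
      then show "\<forall>\<^sub>F n in sequentially.
        \<P>(\<omega> in ?M n. ennreal (\<gamma> n) \<le> mixture f \<pi> (conf_pval \<omega>) (T n + 1) (T n + ?m n)) \<le> \<P>(\<omega> in ?M n. ?X n \<omega>)"
        using eventually_ge_at_top[of 1]
      proof eventually_elim
        case (elim n)
        interpret row: prob_space "?M n" by (rule prow)
        \<comment> \<open>\<open>A * ln (\<gamma> n) \<ge> 1\<close> makes the rounded window
          nonempty, so its start \<open>T n + 1\<close> is an admissible \<open>k\<close> at time
          \<open>T n + ?m n\<close>.\<close>
        have m: "1 \<le> ?m n" and le: "real (T n + ?m n) \<le> T n + A * ln (\<gamma> n)"
          using elim by linarith+
        show ?case
        proof (rule row.finite_measure_mono[OF _ X_sets], safe)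
          fix x l assume g: "ennreal (\<gamma> n) \<le> mixture f \<pi> (conf_pval (x, l)) (T n + 1) (T n + ?m n)"
          show "?X n (x, l)"
            unfolding X_iff
          proof (rule bexI[of _ "T n + ?m n"], intro conjI)
            show "ennreal (\<gamma> n) \<le> Y (conf_pval (x, l)) (T n + ?m n)"
              using g m by (intro order_trans[OF g Y_ge]) auto
          qed (use le T_pos[OF elim(2)] in auto)
        qed
      qed
      show "\<forall>\<^sub>F n in sequentially. \<P>(\<omega> in ?M n. ?X n \<omega>) \<le> 1"
        by (intro always_eventually allI prob_space.prob_le_1 prow)
    qed
    have V_lower: "1 - T n / \<gamma> n \<le> \<P>(\<omega> in ?M n. ?V n \<omega>)" if n: "1 \<le> n" for n
    proof -
      interpret row: prob_space "?M n" by (rule prow)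
      have "1 - T n / \<gamma> n \<le> row.prob {\<omega>\<in>space (?M n). \<forall>t\<in>{1..T n}. \<not> ennreal (\<gamma> n) \<le> S_stat f \<pi> w (conf_pval \<omega>) t}"
        by (intro no_false_alarm_prob P0 P1 prior dens w \<gamma>_pos n)
      also have "\<dots> \<le> row.prob {\<omega>\<in>space (?M n). ?V n \<omega>}"
      proof (rule row.finite_measure_mono[OF _ V_sets])
        have "\<not> ennreal (\<gamma> n) \<le> Y p t" if "\<not> ennreal (\<gamma> n) \<le> S_stat f \<pi> w p t" "t \<in> {1..T n}" for p t
          using that Y_le[of t p] by (meson atLeastAtMost_iff order_trans)
        then show "{\<omega>\<in>space (?M n). \<forall>t\<in>{1..T n}. \<not> ennreal (\<gamma> n) \<le> S_stat f \<pi> w (conf_pval \<omega>) t}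
          \<subseteq> {\<omega>\<in>space (?M n). ?V n \<omega>}"
          unfolding V_iff by blast
      qed
      finally show ?thesis .
    qed
    have r: "(\<lambda>n. 1 - T n / \<gamma> n) \<longlonglongrightarrow> 1" if "(\<lambda>n. real (T n)) \<in> o[sequentially](\<gamma>)"
      using tendsto_diff[OF tendsto_const[of 1] smalloD_tendsto[OF that]] by simp
    note joint = tendsto_joint_and_conditional[where M = ?M and X = ?X and V = ?V,
        OF prow X_sets V_sets X_lim V_lower r]
    show ?thesis
      using X_lim V_lower r joint by (simp add: not_le)
  qed
  have mix_sets: "{\<omega>\<in>space (?M n). x \<le> ennreal (w k) * mixture f \<pi> (conf_pval \<omega>) k t} \<in> sets (?M n)"
    if "1 \<le> k" for n k t x
  proof -
    have [measurable]: "(\<lambda>\<omega>. mixture f \<pi> (conf_pval \<omega>) k t) \<in> borel_measurable (?M n)"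
      using that by (intro measurable_mixture \<pi>.sigma_finite_measure_axioms f) auto
    show ?thesis by measurable
  qed
  have Z: "\<And>b \<omega>. tau_Z f \<pi> w b \<omega> = first_passage b (Z_stat f \<pi> w (conf_pval \<omega>))"
    and S: "\<And>b \<omega>. tau_S f \<pi> w b \<omega> = first_passage b (S_stat f \<pi> w (conf_pval \<omega>))"
    by (simp_all add: tau_Z_def tau_S_def)
  have Z_ge: "mixture f \<pi> p k t \<le> Z_stat f \<pi> w p t" if "1 \<le> k" "k \<le> t" for p k t
    using that w[of k] by (subst le_Z_stat_iff) (auto intro!: bexI[of _ k])
  have Z_sets: "{\<omega>\<in>space (?M n). ennreal b \<le> Z_stat f \<pi> w (conf_pval \<omega>) t} \<in> sets (?M n)" if "1 \<le> t" for n t b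
    unfolding le_Z_stat_iff[OF that]
    by (intro sets.sets_Collect_finite_Ex mix_sets) auto
  have S_sets: "{\<omega>\<in>space (?M n). ennreal b \<le> S_stat f \<pi> w (conf_pval \<omega>) t} \<in> sets (?M n)" for n t b
  proof -
    have [measurable]: "(\<lambda>\<omega>. S_stat f \<pi> w (conf_pval \<omega>) t) \<in> borel_measurable (?M n)"
      unfolding S_stat_def
      by (intro borel_measurable_sum borel_measurable_times_ennreal measurable_mixture
          \<pi>.sigma_finite_measure_axioms f) auto
    show ?thesis by measurable
  qed
  have S_ge: "mixture f \<pi> p k t \<le> S_stat f \<pi> w p t" if "1 \<le> k" "k \<le> t" for p k t
    using Z_ge[OF that] Z_stat_le_S_stat[of t f \<pi> w p] that by (meson order_trans)
  show ?thesis
    using main[OF Z Z_sets Z_ge Z_stat_le_S_stat] main[OF S S_sets S_ge order_refl] by blast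
qed

end
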